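(* Let $F\in\mathcal S(]-\infty,0],\mathbb C)$ and let $N\ge 1$ be an integer. For every real $t<0$, $$\sum_{n=1}^{+\infty}F(nt)=-F^{(-1)}(0)\,t^{-1}+\sum_{k=0}^{2N-1}\frac{\zeta(-k)}{k!}F^{(k)}(0)\,t^k+\frac{1}{2i\pi}\int_{\Re(s)=2N}\Gamma(-s)\,\zeta(-s)\,F^{(s)}(0)\,(-t)^s\,ds .$$
   Context: $\mathcal S(]-\infty,0],\mathbb C)$ is the space of functions $F\in C^\infty(]-\infty,0],\mathbb C)$ (one-sided derivatives at $0$) such that $\lim_{t\to-\infty}|t|^mF^{(n)}(t)=0$ for all integers $n,m\ge 0$. For such $F$, define $F^{(s)}(0)=\frac{1}{\Gamma(-s)}\int_0^{+\infty}u^{-s-1}F(-u)\,du$ for $\Re(s)<0$; this function of $s$ extends to an entire function, still denoted $s\mapsto F^{(s)}(0)$, which at $s=n\in\mathbb N$ equals the usual $n$-th derivative. In particular $F^{(-1)}(0)=\int_{-\infty}^0F(u)\,du$. $\zeta$ is the Riemann zeta function. The integral over $\Re(s)=c$ is along the upward oriented vertical line; the integrand $\Gamma(-s)\zeta(-s)F^{(s)}(0)(-t)^s$ has a removable singularity at $s=2N$ and is extended there by continuity. $(-t)^s=e^{s\ln(-t)}$. *)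

theory Defs
  imports "HOL-Complex_Analysis.Complex_Analysis"
begin

text \<open>Derivatives are taken within \<open>{..0}\<close>, so they are one-sided at \<open>0\<close>, and values of \<open>F\<close> on
  the positive reals are irrelevant on \<open>{..0}\<close>.\<close>

primrec left_deriv :: "nat \<Rightarrow> (real \<Rightarrow> complex) \<Rightarrow> real \<Rightarrow> complex" where
  "left_deriv 0 F = F"
| "left_deriv (Suc n) F = (\<lambda>t. vector_derivative (left_deriv n F) (at t within {..0}))"

definition schwartz_left :: "(real \<Rightarrow> complex) \<Rightarrow> bool" where
  "schwartz_left F \<longleftrightarrow>
     (\<forall>n. left_deriv n F differentiable_on {..0}) \<and>
     (\<forall>m n. ((\<lambda>t. of_real (\<bar>t\<bar> ^ m) * left_deriv n F t) \<longlongrightarrow> 0) at_bot)"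

text \<open>The entire function \<open>s \<mapsto> F\<^sup>(\<^sup>s\<^sup>)(0)\<close>, for \<open>F\<close> satisfying \<^const>\<open>schwartz_left\<close>.\<close>

definition complex_order_deriv0 :: "(real \<Rightarrow> complex) \<Rightarrow> complex \<Rightarrow> complex" where
  "complex_order_deriv0 F = (THE G. G holomorphic_on UNIV \<and>
     (\<forall>s. Re s < 0 \<longrightarrow>
        G s = 1 / Gamma (- s) *
              (LINT u:{0<..}|lborel. of_real u powr (- s - 1) * F (- u))))"

text \<open>The Riemann zeta function by analytic continuation; the value \<open>0\<close> at the pole \<open>1\<close> is a
  convention that makes the description unique.\<close>

definition riemann_zeta :: "complex \<Rightarrow> complex" where
  "riemann_zeta = (THE f. f holomorphic_on (- {1}) \<and> f 1 = 0 \<and>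
     (\<forall>s. Re s > 1 \<longrightarrow> (\<lambda>n. of_nat (Suc n) powr (- s)) sums f s))"

text \<open>Integrals over the upward line \<open>Re s = c\<close>, parametrised by \<open>s = c + \<i> y\<close>, \<open>ds = \<i> dy\<close>.\<close>

definition vline_integrable :: "real \<Rightarrow> (complex \<Rightarrow> complex) \<Rightarrow> bool" where
  "vline_integrable c g \<longleftrightarrow> integrable lborel (\<lambda>y. g (Complex c y))"

definition vline_integral :: "real \<Rightarrow> (complex \<Rightarrow> complex) \<Rightarrow> complex" where
  "vline_integral c g = (LINT y|lborel. g (Complex c y) * \<i>)"

end

theory Submission
  imports Defs "HOL-Probability.Characteristic_Functions" "HOL-Probability.Sinc_Integral"
    "HOL-Real_Asymp.Real_Asymp"
begin

text \<open>
  No contour is shifted. Put \<open>x = - t\<close> and \<open>S x = (\<Sum>n\<ge>1. F (- n x))\<close>. By Euler-Maclaurin, \<open>S x\<close> has an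
  expansion \<open>I / x + \<Sum>k. c\<^sub>k F\<^sup>(\<^sup>k\<^sup>)(0) x\<^sup>k\<close> at \<open>0\<close> whose coefficients \<open>c\<^sub>k\<close> do not depend on \<open>F\<close>. Such an
  expansion continues the Mellin transform of \<open>S\<close>, which for \<open>Re z > 1\<close> is \<open>\<zeta>(z)\<close> times the Mellin
  transform of \<open>F(- x)\<close>; the case \<open>F = exp\<close> yields the zeta function itself and
  \<open>\<zeta>(- k) = (-1)\<^sup>k k! c\<^sub>k\<close>. On the line \<open>Re z = - 2N\<close> the continued transform is the convergent Mellin
  integral of the remainder of \<open>S\<close> after the terms \<open>k < 2N\<close>, because \<open>c\<^sub>2\<^sub>N = 0\<close>. Mellin inversion of that
  remainder is the claim.
\<close>

section \<open>Bilateral Laplace transforms\<close>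

text \<open>Shifting a contour would call for growth bounds for zeta on vertical lines. Here the
  decay on the line comes from x d/dx: it maps a Schwartz function to a Schwartz function and
  multiplies the transform by - z, so the transform of a lattice remainder stays bounded after
  multiplication by z^2. This is the integrability that the inversion needs.

  In the variable v = ln x the Mellin transform is a bilateral Laplace transform: dilations by n
  become translations, and each vertical line carries a Fourier transform.

  The factor 1 / Gamma(z) is dictated by the definition of F^(s)(0) with z = - s. It cancels the
  poles at 0, -1, -2, ..., so that only a pole at 1 can remain and the coefficients of the expansion
  become values of the continuation.

  In general Re z = - 2N is only the edge of the strip where the transform of the remainder after 2N
  terms converges. The vanishing of the next coefficient, an odd Bernoulli number up to a factor,
  widens the strip to - 2N - 1 < Re z < 1 - 2N, with the line in its interior. It is also why the
  singularity at s = 2N is removable.\<close>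

lemma has_bochner_integral_exp_Ioi:
  fixes w :: complex
  assumes w: "Re w < 0"
  shows "has_bochner_integral lborel (\<lambda>v::real. indicator {0<..} v *\<^sub>R exp (w * of_real v)) (- 1 / w)"
proof -
  have [simp]: "w \<noteq> 0" using w by auto
  have int: "set_integrable lborel {0<..} (\<lambda>v::real. exp (w * of_real v))"
  proof -
    have "set_integrable lborel {0<..} (\<lambda>x. exp (- (x * - Re w)))"
      using w by (intro integrable_I0i_exp_mscale) auto
    thus ?thesis unfolding set_integrable_def
      by (rule Bochner_Integration.integrable_bound) (auto simp: indicator_def mult.commute)
  qed
  have lim: "((\<lambda>v::real. exp (w * of_real v)) \<longlongrightarrow> 0) at_top"
  proof (rule tendsto_norm_zero_cancel)
    have "((\<lambda>v::real. exp (Re w * v)) \<longlongrightarrow> 0) at_top" using w by real_asymp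
    thus "((\<lambda>v::real. norm (exp (w * of_real v))) \<longlongrightarrow> 0) at_top" by simp
  qed
  have "((\<lambda>v::real. exp (w * of_real v)) \<longlongrightarrow> exp (w * of_real 0)) (at_right 0)"
    by (intro tendsto_intros)
  hence lim0: "((\<lambda>v::real. exp (w * of_real v)) \<longlongrightarrow> 1) (at_right 0)"
    by simp
  have "(LBINT v=ereal 0..\<infinity>. exp (w * of_real v)) = 0 / w - 1 / w"
  proof (rule interval_integral_FTC_integrable[where F = "\<lambda>v. exp (w * of_real v) / w"])
    show "((\<lambda>v. exp (w * of_real v) / w) has_vector_derivative exp (w * of_real v)) (at v)" for v
      by (rule has_vector_derivative_real_field) (auto intro!: derivative_eq_intros)
    show "(((\<lambda>v. exp (w * of_real v) / w) \<circ> real_of_ereal) \<longlongrightarrow> 0 / w) (at_left \<infinity>)"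
      unfolding ereal_tendsto_simps by (intro tendsto_divide lim tendsto_const) auto
    show "(((\<lambda>v. exp (w * of_real v) / w) \<circ> real_of_ereal) \<longlongrightarrow> 1 / w) (at_right (ereal 0))"
      unfolding ereal_tendsto_simps by (intro tendsto_divide lim0 tendsto_const) auto
  qed (use int in \<open>auto intro!: continuous_intros\<close>)
  thus ?thesis using int
    by (simp add: has_bochner_integral_iff set_integrable_def interval_lebesgue_integral_0_infty
          set_lebesgue_integral_def flip: zero_ereal_def)
qed

lemma has_bochner_integral_exp_Iic:
  fixes w :: complex
  assumes w: "Re w > 0"
  shows "has_bochner_integral lborel (\<lambda>v::real. indicator {..0} v *\<^sub>R exp (w * of_real v)) (1 / w)"
proof -
  have "has_bochner_integral lborel (\<lambda>v::real. indicator {0<..} v *\<^sub>R exp (- w * of_real v)) (1 / w)"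
    using has_bochner_integral_exp_Ioi[of "- w"] w by simp
  hence "has_bochner_integral lborel (\<lambda>v::real. indicator {..<0} v *\<^sub>R exp (w * of_real v)) (1 / w)"
    by (subst lborel_has_bochner_integral_real_affine_iff[where c = "-1" and t = 0])
       (auto simp: indicator_def cong: if_cong)
  thus ?thesis
    by (subst has_bochner_integral_discrete_difference[of "{0}" _ _
           "\<lambda>v::real. indicator {..<0} v *\<^sub>R exp (w * of_real v)"]) (auto simp: indicator_def)
qed

lemma norm_exp_minus_one_le:
  fixes u :: complex
  shows "norm (exp u - 1) \<le> norm u * exp (norm u)"
  using Taylor_exp_field[of u 0] by (simp add: mult.commute)

lemma exp_mult_le_sum:
  fixes a b c v :: real
  assumes "a \<le> c" "c \<le> b"
  shows "exp (c * v) \<le> exp (a * v) + exp (b * v)"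
proof (cases "v \<ge> 0")
  case True
  hence "exp (c * v) \<le> exp (b * v)" using assms by (simp add: mult_right_mono)
  thus ?thesis by (smt (verit) exp_gt_zero)
next
  case False
  hence "exp (c * v) \<le> exp (a * v)" using assms by (simp add: mult_right_mono_neg)
  thus ?thesis by (smt (verit) exp_gt_zero)
qed

lemma integrable_laplace_strip:
  fixes \<psi> :: "real \<Rightarrow> complex"
  assumes "integrable lborel (\<lambda>v. exp (of_real (a * v)) * \<psi> v)"
    and "integrable lborel (\<lambda>v. exp (of_real (b * v)) * \<psi> v)"
    and [measurable]: "\<psi> \<in> borel_measurable borel"
    and z: "a \<le> Re z" "Re z \<le> b"
  shows "integrable lborel (\<lambda>v. exp (z * of_real v) * \<psi> v)"
proof (rule Bochner_Integration.integrable_bound)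
  show "integrable lborel (\<lambda>v. norm (exp (of_real (a * v)) * \<psi> v) + norm (exp (of_real (b * v)) * \<psi> v))"
    by (intro Bochner_Integration.integrable_add integrable_norm assms)
  show "AE v in lborel. norm (exp (z * of_real v) * \<psi> v)
      \<le> norm (norm (exp (of_real (a * v)) * \<psi> v) + norm (exp (of_real (b * v)) * \<psi> v))"
  proof (intro always_eventually allI)
    fix v :: real
    have "exp (Re z * v) * norm (\<psi> v) \<le> (exp (a * v) + exp (b * v)) * norm (\<psi> v)"
      by (intro mult_right_mono exp_mult_le_sum z) auto
    thus "norm (exp (z * of_real v) * \<psi> v)
      \<le> norm (norm (exp (of_real (a * v)) * \<psi> v) + norm (exp (of_real (b * v)) * \<psi> v))"
      by (simp add: norm_mult distrib_right)
  qed
qed auto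

text \<open>A majorant independent of \<open>h\<close>, for differentiation under the integral. One
  \<delta> is spent on exp(|h v|), a second one on absorbing the factor |v| into exp(\<delta> |v|) /
  \<delta>; hence the abscissae are moved by 2 \<delta>.\<close>

lemma exp_difference_quotient_bound:
  fixes z h :: complex and v \<delta> :: real
  assumes "\<delta> > 0" "norm h < \<delta>" "h \<noteq> 0"
  shows "norm ((exp ((z + h) * v) - exp (z * v)) / h)
           \<le> (exp ((Re z - 2 * \<delta>) * v) + exp ((Re z + 2 * \<delta>) * v)) / \<delta>"
proof -
  have "norm (exp (h * v) - 1) \<le> norm (h * v) * exp (norm (h * v))"
    by (rule norm_exp_minus_one_le)
  hence "norm (exp (h * v) - 1) / norm h \<le> \<bar>v\<bar> * exp (norm h * \<bar>v\<bar>)"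
    using assms(3) by (simp add: norm_mult field_simps)
  also have "\<bar>v\<bar> * exp (norm h * \<bar>v\<bar>) \<le> exp (\<delta> * \<bar>v\<bar>) / \<delta> * exp (\<delta> * \<bar>v\<bar>)"
  proof (intro mult_mono)
    have "1 + \<delta> * \<bar>v\<bar> \<le> exp (\<delta> * \<bar>v\<bar>)" by (rule exp_ge_add_one_self)
    hence "\<delta> * \<bar>v\<bar> \<le> exp (\<delta> * \<bar>v\<bar>)" by linarith
    hence "\<bar>v\<bar> * \<delta> \<le> exp (\<delta> * \<bar>v\<bar>)" by (subst mult.commute)
    thus "\<bar>v\<bar> \<le> exp (\<delta> * \<bar>v\<bar>) / \<delta>"
      using assms(1) by (simp add: pos_le_divide_eq)
    show "exp (norm h * \<bar>v\<bar>) \<le> exp (\<delta> * \<bar>v\<bar>)"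
      using assms by (simp add: mult_right_mono)
  qed (use assms in auto)
  finally have 1: "norm (exp (h * v) - 1) / norm h \<le> exp (\<delta> * \<bar>v\<bar>) / \<delta> * exp (\<delta> * \<bar>v\<bar>)" .
  have "exp ((z + h) * v) - exp (z * v) = exp (z * v) * (exp (h * v) - 1)"
    by (simp add: ring_distribs exp_add)
  hence "norm ((exp ((z + h) * v) - exp (z * v)) / h) = exp (Re z * v) * (norm (exp (h * v) - 1) / norm h)"
    by (simp add: norm_divide norm_mult)
  also have "\<dots> \<le> exp (Re z * v) * (exp (\<delta> * \<bar>v\<bar>) / \<delta> * exp (\<delta> * \<bar>v\<bar>))"
    by (intro mult_left_mono 1) auto
  also have "\<dots> = exp (Re z * v + (\<delta> * \<bar>v\<bar> + \<delta> * \<bar>v\<bar>)) / \<delta>"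
    unfolding exp_add by simp
  also have "\<dots> \<le> (exp ((Re z - 2 * \<delta>) * v) + exp ((Re z + 2 * \<delta>) * v)) / \<delta>"
  proof (intro divide_right_mono)
    have "Re z * v + (\<delta> * \<bar>v\<bar> + \<delta> * \<bar>v\<bar>) \<in> {(Re z - 2 * \<delta>) * v, (Re z + 2 * \<delta>) * v}"
      by (cases "v \<ge> 0") (simp_all add: algebra_simps)
    thus "exp (Re z * v + (\<delta> * \<bar>v\<bar> + \<delta> * \<bar>v\<bar>)) \<le> exp ((Re z - 2 * \<delta>) * v) + exp ((Re z + 2 * \<delta>) * v)"
      by (smt (verit) exp_gt_zero insertE singletonD)
  qed (use assms in auto)
  finally show ?thesis .
qed

lemma holomorphic_on_laplace_strip:
  fixes \<psi> :: "real \<Rightarrow> complex"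
  assumes ia: "integrable lborel (\<lambda>v. exp (of_real (a * v)) * \<psi> v)"
    and ib: "integrable lborel (\<lambda>v. exp (of_real (b * v)) * \<psi> v)"
    and [measurable]: "\<psi> \<in> borel_measurable borel"
  shows "(\<lambda>z. LINT v|lborel. exp (z * of_real v) * \<psi> v) holomorphic_on {z. a < Re z \<and> Re z < b}"
proof -
  let ?L = "\<lambda>z. LINT v|lborel. exp (z * of_real v) * \<psi> v"
  have "(?L has_field_derivative (LINT v|lborel. of_real v * exp (z * of_real v) * \<psi> v)) (at z)"
    if z: "a < Re z" "Re z < b" for z
  proof -
    \<comment> \<open>A third of the distance to the boundary, so that the majorant at Re z - 2
      \<delta> and Re z + 2 \<delta> is still integrable.\<close>
    define \<delta> where "\<delta> = min (Re z - a) (b - Re z) / 3"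
    have \<delta>: "\<delta> > 0" "a \<le> Re z - 2 * \<delta>" "Re z + 2 * \<delta> \<le> b" "a \<le> Re z - \<delta>" "Re z + \<delta> \<le> b"
      using z by (auto simp: \<delta>_def min_def field_simps)
    let ?q = "\<lambda>h. (?L (z + h) - ?L z) / h"
    have int: "integrable lborel (\<lambda>v. exp (w * of_real v) * \<psi> v)" if "norm (w - z) \<le> 2 * \<delta>" for w
      by (rule integrable_laplace_strip[OF ia ib])
         (use \<delta> that abs_Re_le_cmod[of "w - z"] in auto)
    have "(?q \<longlongrightarrow> (LINT v|lborel. of_real v * exp (z * of_real v) * \<psi> v)) (at 0 within ball 0 \<delta>)"
      unfolding tendsto_at_iff_sequentially
    proof safe
      fix X :: "nat \<Rightarrow> complex"
      assume X: "\<forall>i. X i \<in> ball 0 \<delta> - {0}" and X0: "X \<longlonglongrightarrow> 0"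
      let ?f = "\<lambda>i v. (exp ((z + X i) * of_real v) - exp (z * of_real v)) / X i * \<psi> v"
      have eq: "?q (X i) = (LINT v|lborel. ?f i v)" for i
      proof -
        have "?L (z + X i) - ?L z = (LINT v|lborel. exp ((z + X i) * of_real v) * \<psi> v - exp (z * of_real v) * \<psi> v)"
        proof (rule Bochner_Integration.integral_diff[symmetric]; rule int)
          have "norm (X i) < \<delta>" using X by (auto simp: dist_norm)
          thus "norm (z + X i - z) \<le> 2 * \<delta>" using \<delta>(1) by simp
          show "norm (z - z) \<le> 2 * \<delta>" using \<delta>(1) by simp
        qed
        also have "\<dots> / X i = (LINT v|lborel. ?f i v)"
          unfolding integral_divide_zero[symmetric]
          by (intro Bochner_Integration.integral_cong refl) (simp add: left_diff_distrib diff_divide_distrib)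
        finally show ?thesis .
      qed
      have "(\<lambda>i. LINT v|lborel. ?f i v) \<longlonglongrightarrow> (LINT v|lborel. of_real v * exp (z * of_real v) * \<psi> v)"
      proof (rule integral_dominated_convergence[where w = "\<lambda>v. (norm (exp ((z - 2 * \<delta>) * of_real v) * \<psi> v)
                + norm (exp ((z + 2 * \<delta>) * of_real v) * \<psi> v)) / \<delta>"])
        show "integrable lborel (\<lambda>v. (norm (exp ((z - 2 * \<delta>) * of_real v) * \<psi> v)
                + norm (exp ((z + 2 * \<delta>) * of_real v) * \<psi> v)) / \<delta>)"
          using \<delta> by (intro integrable_divide_zero Bochner_Integration.integrable_add integrable_norm int) (auto simp: norm_mult)
        show "AE v in lborel. norm (?f i v) \<le> (norm (exp ((z - 2 * \<delta>) * of_real v) * \<psi> v)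
                + norm (exp ((z + 2 * \<delta>) * of_real v) * \<psi> v)) / \<delta>" for i
        proof (intro always_eventually allI)
          fix v
          have "norm (?f i v) \<le> (exp ((Re z - 2 * \<delta>) * v) + exp ((Re z + 2 * \<delta>) * v)) / \<delta> * norm (\<psi> v)"
            unfolding norm_mult[of _ "\<psi> v"]
            by (intro mult_right_mono exp_difference_quotient_bound \<delta>) (use X in auto)
          thus "norm (?f i v) \<le> (norm (exp ((z - 2 * \<delta>) * of_real v) * \<psi> v)
                + norm (exp ((z + 2 * \<delta>) * of_real v) * \<psi> v)) / \<delta>"
            by (simp add: norm_mult ring_distribs add_divide_distrib)
        qed
        show "AE v in lborel. (\<lambda>i. ?f i v) \<longlonglongrightarrow> of_real v * exp (z * of_real v) * \<psi> v"
        proof (intro always_eventually allI tendsto_mult tendsto_const)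
          fix v :: real
          have "((\<lambda>w. exp (w * of_real v)) has_field_derivative of_real v * exp (z * of_real v)) (at z)"
            by (auto intro!: derivative_eq_intros)
          hence "((\<lambda>h. (exp ((z + h) * of_real v) - exp (z * of_real v)) / h) \<longlongrightarrow> of_real v * exp (z * of_real v)) (at 0)"
            by (simp add: DERIV_def)
          thus "(\<lambda>i. (exp ((z + X i) * of_real v) - exp (z * of_real v)) / X i) \<longlonglongrightarrow> of_real v * exp (z * of_real v)"
            using X X0 unfolding tendsto_at_iff_sequentially comp_def by blast
        qed
      qed auto
      thus "((?q) \<circ> X) \<longlonglongrightarrow> (LINT v|lborel. of_real v * exp (z * of_real v) * \<psi> v)"
        unfolding comp_def eq .
    qed
    moreover have "at 0 within ball 0 \<delta> = at (0::complex)"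
      using \<delta>(1) by (intro at_within_open) auto
    ultimately show ?thesis unfolding DERIV_def by metis
  qed
  moreover have "open {z. a < Re z \<and> Re z < b}"
    by (intro open_Collect_conj open_Collect_less continuous_intros)
  ultimately show ?thesis by (force simp: holomorphic_on_open)
qed

text \<open>The substitution u = exp v, which links the Mellin integral of
  \<open>complex_order_deriv0\<close> and the Gamma integral to the Laplace form used everywhere
  else.\<close>

lemma integral_powr_exp_substitution:
  fixes h :: "real \<Rightarrow> complex"
  assumes "set_borel_measurable borel {0<..} h"
    and int: "integrable lborel (\<lambda>v. exp (z * of_real v) * h (exp v))"
  shows "(LINT u:{0<..}|lborel. of_real u powr (z - 1) * h u) = (LINT v|lborel. exp (z * of_real v) * h (exp v))"
proof -
  let ?f = "\<lambda>u. of_real u powr (z - 1) * h u"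
  let ?g = "\<lambda>v. exp (z * of_real v) * h (exp v)"
  have eq: "\<bar>exp v\<bar> *\<^sub>R ?f (exp v) = ?g v" for v
    by (simp add: powr_def scaleR_conv_of_real exp_of_real[symmetric] left_diff_distrib exp_diff
        Ln_of_real)
  have g1: "?g absolutely_integrable_on UNIV" "integral UNIV ?g = integral\<^sup>L lborel ?g"
    using int integrable_completion[of ?g lborel] integral_completion[of ?g lborel]
       integral_lborel[of ?g]
    by (auto simp: set_integrable_def borel_measurable_integrable)
  have "?f absolutely_integrable_on (exp ` UNIV) \<and> integral (exp ` UNIV) ?f = integral\<^sup>L lborel ?g"
    by (rule has_absolute_integral_change_of_variables_real[where h = exp, THEN iffD1])
       (use g1 eq in \<open>auto intro!: derivative_eq_intros inj_onI simp del: abs_exp_cancel\<close>)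
  moreover have "exp ` UNIV = {0::real<..}"
    by (auto simp: image_iff) (metis exp_ln)
  ultimately have f: "?f absolutely_integrable_on {0<..}" "integral {0<..} ?f = integral\<^sup>L lborel ?g"
    by auto
  have "(LINT u:{0<..}|lebesgue. ?f u) = integral\<^sup>L lborel ?g"
    using set_lebesgue_integral_eq_integral(2)[OF f(1)] f(2) by simp
  \<comment> \<open>The change of variables yields an integral for the completed measure; as the
    integrand is Borel on the half-line, the integral for \<open>lborel\<close> is the same.\<close>
  moreover have "(LINT u:{0<..}|lebesgue. ?f u) = (LINT u:{0<..}|lborel. ?f u)"
  proof -
    have [measurable]: "(\<lambda>u. indicator {0<..} u *\<^sub>R h u) \<in> borel_measurable borel"
      using assms(1) by (simp add: set_borel_measurable_def)
    have "(\<lambda>u. indicator {0<..} u *\<^sub>R ?f u) = (\<lambda>u::real. of_real u powr (z - 1) * (indicator {0<..} u *\<^sub>R h u))"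
      by auto
    also have "\<dots> \<in> borel_measurable borel"
      unfolding powr_def by measurable
    finally have "(\<lambda>u. indicator {0<..} u *\<^sub>R ?f u) \<in> borel_measurable lborel" by simp
    thus ?thesis unfolding set_lebesgue_integral_def by (rule integral_completion)
  qed
  ultimately show ?thesis by simp
qed

section \<open>Fourier inversion\<close>

lemma integrable_std_normal_density: "integrable lborel std_normal_density"
  using integrable_std_normal_moment[of 0] by simp

lemma std_normal_density_le: "std_normal_density x \<le> std_normal_density 0"
  by (simp add: std_normal_density_def divide_right_mono)

lemma integral_std_normal_iexp:
  "(LINT x|lborel. std_normal_density x *\<^sub>R iexp (t * x)) = of_real (exp (- (t\<^sup>2) / 2))"
proof -
  have "of_real (exp (- (t\<^sup>2) / 2)) = (CLINT x|std_normal_distribution. iexp (t * x))"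
    using fun_cong[OF char_std_normal_distribution, of t] by (simp add: char_def)
  also have "\<dots> = (LINT x|lborel. std_normal_density x *\<^sub>R iexp (t * x))"
    by (subst integral_density) auto
  finally show ?thesis by simp
qed

lemma integral_std_normal_iexp_scaled:
  assumes "\<epsilon> > 0"
  shows "(LINT y|lborel. std_normal_density (\<epsilon> * y) *\<^sub>R iexp (y * t)) = of_real (exp (- ((t / \<epsilon>)\<^sup>2) / 2) / \<epsilon>)"
proof -
  have "of_real (exp (- ((t / \<epsilon>)\<^sup>2) / 2)) = (LINT x|lborel. std_normal_density x *\<^sub>R iexp (t / \<epsilon> * x))"
    by (rule integral_std_normal_iexp[symmetric])
  also have "\<dots> = \<epsilon> *\<^sub>R (LINT y|lborel. std_normal_density (\<epsilon> * y) *\<^sub>R iexp (y * t))"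
    using assms by (subst lborel_integral_real_affine[where c = \<epsilon> and t = 0])
       (auto simp: mult.commute intro!: arg_cong2[of _ _ _ _ scaleR] Bochner_Integration.integral_cong)
  finally show ?thesis using assms by (simp add: scaleR_conv_of_real field_simps)
qed

lemma integrable_scaleR_bounded:
  fixes h :: "real \<Rightarrow> complex"
  assumes "integrable lborel f" "h \<in> borel_measurable borel" "\<And>x. norm (h x) \<le> B" 
  shows "integrable lborel (\<lambda>x. f x *\<^sub>R h x)"
proof (rule Bochner_Integration.integrable_bound)
  show "integrable lborel (\<lambda>x. f x * B)" using assms by simp
  show "AE x in lborel. norm (f x *\<^sub>R h x) \<le> norm (f x * B)"
  proof (intro always_eventually allI)
    fix x
    have "norm (h x) \<le> \<bar>B\<bar>" using assms(3)[of x] by linarith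
    thus "norm (f x *\<^sub>R h x) \<le> norm (f x * B)" by (simp add: abs_mult mult_left_mono)
  qed
qed (use assms in measurable)

text \<open>Damping the inverse transform by a Gaussian of width \<open>1 / \<epsilon>\<close> replaces \<open>r\<close> by its average over a
  Gaussian of width \<open>\<epsilon>\<close>; both sides converge as \<open>\<epsilon> \<rightarrow> 0\<close>.\<close>

lemma gaussian_mean_fourier_transform:
  fixes r :: "real \<Rightarrow> complex"
  assumes ir: "integrable lborel r" and \<epsilon>: "\<epsilon> > 0"
  shows "(LINT y|lborel. std_normal_density (\<epsilon> * y) *\<^sub>R (iexp (y * v) * (LINT w|lborel. iexp (- (y * w)) * r w)))
     = of_real (sqrt (2 * pi)) * (LINT u|lborel. std_normal_density u *\<^sub>R r (v + \<epsilon> * u))"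
proof -
  have [measurable]: "r \<in> borel_measurable borel" using ir by auto
  let ?f = "\<lambda>w y. std_normal_density (\<epsilon> * y) *\<^sub>R (iexp (y * (v - w)) * r w)"
  have id: "integrable lborel (\<lambda>y. std_normal_density (\<epsilon> * y))"
    using lborel_integrable_real_affine[OF integrable_std_normal_density, of \<epsilon> 0] \<epsilon> by simp
  \<comment> \<open>Joint integrability: the Gaussian factor supplies it in \<open>y\<close>, the
    function \<open>r\<close> in \<open>w\<close>.\<close>
  have int: "integrable (lborel \<Otimes>\<^sub>M lborel) (case_prod ?f)"
  proof (rule lborel_pair.Fubini_integrable)
    show "case_prod ?f \<in> borel_measurable (lborel \<Otimes>\<^sub>M lborel)" by measurable
    have "(\<lambda>w. LINT y|lborel. norm (case_prod ?f (w, y))) =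
            (\<lambda>w. norm (r w) * (LINT y|lborel. std_normal_density (\<epsilon> * y)))"
      by (simp add: norm_mult mult.commute)
    thus "integrable lborel (\<lambda>w. LINT y|lborel. norm (case_prod ?f (w, y)))"
      using ir by simp
    show "AE w in lborel. integrable lborel (\<lambda>y. case_prod ?f (w, y))"
    proof (intro always_eventually allI)
      fix w
      show "integrable lborel (\<lambda>y. case_prod ?f (w, y))"
        unfolding case_prod_conv
        by (rule integrable_scaleR_bounded[OF id, of _ "norm (r w)"]) (auto simp: norm_mult)
    qed
  qed
  have "(LINT y|lborel. std_normal_density (\<epsilon> * y) *\<^sub>R (iexp (y * v) * (LINT w|lborel. iexp (- (y * w)) * r w)))
      = (LINT y|lborel. LINT w|lborel. ?f w y)"
    by (intro Bochner_Integration.integral_cong refl)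
       (simp add: right_diff_distrib exp_diff exp_minus field_simps
          flip: integral_mult_right_zero integral_scaleR_right)
  also have "\<dots> = (LINT w|lborel. LINT y|lborel. ?f w y)"
    by (rule lborel_pair.Fubini_integral[OF int])
  also have "\<dots> = (LINT w|lborel. of_real (exp (- (((v - w) / \<epsilon>)\<^sup>2) / 2) / \<epsilon>) * r w)"
    by (simp only: mult_scaleR_left[symmetric] integral_mult_left_zero integral_std_normal_iexp_scaled[OF \<epsilon>])
  also have "\<dots> = \<epsilon> *\<^sub>R (LINT u|lborel. of_real (exp (- (u\<^sup>2) / 2) / \<epsilon>) * r (v + \<epsilon> * u))"
    using \<epsilon> by (subst lborel_integral_real_affine[where c = \<epsilon> and t = v]) simp_all
  also have "\<dots> = (LINT u|lborel. of_real (sqrt (2 * pi)) * (std_normal_density u *\<^sub>R r (v + \<epsilon> * u)))"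
    unfolding integral_scaleR_right[symmetric]
    by (intro Bochner_Integration.integral_cong refl)
       (use \<epsilon> in \<open>simp add: std_normal_density_def scaleR_conv_of_real flip: of_real_mult\<close>)
  also have "\<dots> = of_real (sqrt (2 * pi)) * (LINT u|lborel. std_normal_density u *\<^sub>R r (v + \<epsilon> * u))"
    by (rule integral_mult_right_zero)
  finally show ?thesis .
qed

text \<open>Integrability of \<open>ft\<close> justifies the limit of the damped inverse transform;
  boundedness and continuity of \<open>r\<close> justify the limit of the Gaussian averages. Both
  are dominated convergence.\<close>

theorem fourier_inversion:
  fixes r :: "real \<Rightarrow> complex"
  defines "ft \<equiv> \<lambda>y. LINT w|lborel. iexp (- (y * w)) * r w"
  assumes ir: "integrable lborel r" and cr: "continuous_on UNIV r" and bnd: "\<And>v. norm (r v) \<le> B"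
    and ift: "integrable lborel ft"
  shows "(LINT y|lborel. iexp (y * v) * ft y) = 2 * of_real pi * r v"
proof -
  have [measurable]: "r \<in> borel_measurable borel" "ft \<in> borel_measurable borel"
    using ir ift by auto
  let ?J = "\<lambda>\<epsilon>. LINT y|lborel. std_normal_density (\<epsilon> * y) *\<^sub>R (iexp (y * v) * ft y)"
  define X :: "nat \<Rightarrow> real" where "X n = inverse (real (Suc n))" for n
  have X: "X \<longlonglongrightarrow> 0" "\<And>n. X n > 0"
    unfolding X_def by (rule LIMSEQ_inverse_real_of_nat) auto
  have cont_d: "isCont std_normal_density x" for x
    unfolding std_normal_density_def by (intro continuous_intros) auto
  have "(\<lambda>n. ?J (X n)) \<longlonglongrightarrow> (LINT y|lborel. std_normal_density 0 *\<^sub>R (iexp (y * v) * ft y))"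
  proof (rule integral_dominated_convergence[where w = "\<lambda>y. std_normal_density 0 * norm (ft y)"])
    show "integrable lborel (\<lambda>y. std_normal_density 0 * norm (ft y))" using ift by simp
    show "AE y in lborel. (\<lambda>n. std_normal_density (X n * y) *\<^sub>R (iexp (y * v) * ft y))
            \<longlonglongrightarrow> std_normal_density 0 *\<^sub>R (iexp (y * v) * ft y)"
    proof (intro always_eventually allI tendsto_scaleR tendsto_const)
      fix y
      have "(\<lambda>n. X n * y) \<longlonglongrightarrow> 0 * y" by (intro tendsto_intros X)
      thus "(\<lambda>n. std_normal_density (X n * y)) \<longlonglongrightarrow> std_normal_density 0"
        by (intro isCont_tendsto_compose[OF cont_d]) auto
    qed
    show "AE y in lborel. norm (std_normal_density (X n * y) *\<^sub>R (iexp (y * v) * ft y))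
            \<le> std_normal_density 0 * norm (ft y)" for n
      using std_normal_density_le by (auto simp: norm_mult normal_density_nonneg intro!: mult_right_mono)
  qed auto
  moreover have "(\<lambda>n. ?J (X n)) \<longlonglongrightarrow> of_real (sqrt (2 * pi)) * r v"
  proof -
    have "(\<lambda>n. LINT u|lborel. std_normal_density u *\<^sub>R r (v + X n * u)) \<longlonglongrightarrow> (LINT u|lborel. std_normal_density u *\<^sub>R r v)"
    proof (rule integral_dominated_convergence[where w = "\<lambda>u. std_normal_density u * B"])
      show "integrable lborel (\<lambda>u. std_normal_density u * B)" using integrable_std_normal_density by simp
      show "AE u in lborel. (\<lambda>n. std_normal_density u *\<^sub>R r (v + X n * u)) \<longlonglongrightarrow> std_normal_density u *\<^sub>R r v"
      proof (intro always_eventually allI tendsto_scaleR tendsto_const)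
        fix u
        have "(\<lambda>n. v + X n * u) \<longlonglongrightarrow> v + 0 * u" by (intro tendsto_intros X)
        thus "(\<lambda>n. r (v + X n * u)) \<longlonglongrightarrow> r v"
          using cr by (intro isCont_tendsto_compose[of _ r]) (auto simp: continuous_on_eq_continuous_at)
      qed
      show "AE u in lborel. norm (std_normal_density u *\<^sub>R r (v + X n * u)) \<le> std_normal_density u * B" for n
        using bnd by (auto simp: normal_density_nonneg intro!: mult_left_mono)
    qed auto
    moreover have "(LINT u|lborel. std_normal_density u *\<^sub>R r v) = r v"
      using integral_std_normal_moment_even[of 0] integrable_std_normal_density by simp
    ultimately show ?thesis
      unfolding ft_def gaussian_mean_fourier_transform[OF ir X(2)] by (intro tendsto_intros) simp
  qed
  ultimately have "std_normal_density 0 *\<^sub>R (LINT y|lborel. iexp (y * v) * ft y) = of_real (sqrt (2 * pi)) * r v"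
    by (simp add: LIMSEQ_unique)
  \<comment> \<open>The density at 0 is 1 / sqrt(2 pi); clearing it produces the second factor
    sqrt(2 pi).\<close>
  hence "of_real (sqrt (2 * pi)) * (std_normal_density 0 *\<^sub>R (LINT y|lborel. iexp (y * v) * ft y))
      = of_real (sqrt (2 * pi)) * (of_real (sqrt (2 * pi)) * r v)"
    by simp
  moreover have "of_real (sqrt (2 * pi)) * (std_normal_density 0 *\<^sub>R x) = x" for x :: complex
    by (simp add: std_normal_density_def scaleR_conv_of_real)
  moreover have "complex_of_real (sqrt (2 * pi)) * (of_real (sqrt (2 * pi)) * x) = 2 * of_real pi * x" for x
  proof -
    have "complex_of_real (sqrt (2 * pi)) * of_real (sqrt (2 * pi)) = 2 * of_real pi"
      unfolding of_real_mult[symmetric] by simp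
    thus ?thesis by (simp only: mult.assoc[symmetric])
  qed
  ultimately show ?thesis by metis
qed

section \<open>Analytic continuation from asymptotic expansions\<close>

text \<open>In the variable \<open>x = exp v\<close> this is a function on the positive reals which decays rapidly at
  infinity and has the asymptotic expansion \<open>b / x + a\<^sub>0 + a\<^sub>1 x + \<dots>\<close> at \<open>0\<close>, and
  \<open>LINT v|lborel. exp (z * v) * \<psi> v\<close> is its Mellin transform.\<close>

locale laplace_expansion =
  fixes \<psi> :: "real \<Rightarrow> complex" and b :: complex and a :: "nat \<Rightarrow> complex"
  assumes cont: "continuous_on UNIV \<psi>"
    and expansion: "\<And>K. \<exists>C. \<forall>v\<le>0. norm (\<psi> v - b * of_real (exp (- v)) - (\<Sum>k<K. a k * of_real (exp (real k * v))))
              \<le> C * exp (real K * v)"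
    and decay: "\<And>m. \<exists>C. \<forall>v\<ge>0. norm (\<psi> v) \<le> C * exp (- (real m * v))"
begin

lemma measurable_psi [measurable]: "\<psi> \<in> borel_measurable borel"
  using cont by (rule borel_measurable_continuous_onI)

definition remainder :: "nat \<Rightarrow> real \<Rightarrow> complex" where
  "remainder K v = \<psi> v - b * of_real (exp (- v)) - (\<Sum>k<K. a k * of_real (exp (real k * v)))"

text \<open>Subtracting the expansion only where v <= 0 gains decay at minus infinity without
  spoiling the decay at plus infinity, so the transform converges on the whole half-plane Re z > -
  K.\<close>

definition cut :: "nat \<Rightarrow> real \<Rightarrow> complex" where
  "cut K v = (if v \<le> 0 then remainder K v else \<psi> v)"

text \<open>The Mellin transform divided by \<open>Gamma z\<close>, continued to \<open>Re z > - K\<close>. Its polar parts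
  \<open>a\<^sub>k / (z + k)\<close> are cancelled by the zeros of \<open>rGamma\<close>: \<open>rGamma z / (z + k)\<close> is written in the
  pole-free form \<open>pochhammer z k * rGamma (z + k + 1)\<close>.\<close>

definition continuation_upto :: "nat \<Rightarrow> complex \<Rightarrow> complex" where
  "continuation_upto K z = rGamma z * (LINT v|lborel. exp (z * of_real v) * cut K v) + b * rGamma z / (z - 1)
       + (\<Sum>k<K. a k * pochhammer z k * rGamma (z + of_nat k + 1))"

text \<open>Any K > - Re z would do, by \<open>continuation_eq\<close>; this formula merely picks
  one.\<close>

definition continuation :: "complex \<Rightarrow> complex" where
  "continuation z = continuation_upto (nat \<lceil>- Re z\<rceil> + 1) z"

lemma measurable_remainder [measurable]: "remainder K \<in> borel_measurable borel"
  unfolding remainder_def by measurable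

lemma measurable_cut [measurable]: "cut K \<in> borel_measurable borel"
  unfolding cut_def by measurable

lemma integrable_cut:
  assumes "Re z > - real K"
  shows "integrable lborel (\<lambda>v. exp (z * of_real v) * cut K v)"
proof -
  obtain C where C: "\<And>v. v \<le> 0 \<Longrightarrow> norm (remainder K v) \<le> C * exp (real K * v)"
    using expansion[of K] unfolding remainder_def by blast
  obtain m :: nat where m: "real m > Re z" using reals_Archimedean2 by blast
  obtain D where D: "\<And>v. v \<ge> 0 \<Longrightarrow> norm (\<psi> v) \<le> D * exp (- (real m * v))"
    using decay[of m] by blast
  have "norm (remainder K 0) \<le> C" "norm (\<psi> 0) \<le> D" using C[of 0] D[of 0] by auto
  hence CD: "C \<ge> 0" "D \<ge> 0" using norm_ge_zero order_trans by blast+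
  let ?g = "\<lambda>v::real. C *\<^sub>R (indicator {..0} v *\<^sub>R exp (of_real (Re z + real K) * of_real v)) +
       D *\<^sub>R (indicator {0<..} v *\<^sub>R exp (of_real (Re z - real m) * of_real v)) :: complex"
  show ?thesis
  proof (rule Bochner_Integration.integrable_bound[of _ ?g])
    show "integrable lborel ?g"
    proof (intro Bochner_Integration.integrable_add integrable_scaleR_right)
      show "integrable lborel (\<lambda>v::real. indicator {..0} v *\<^sub>R exp (of_real (Re z + real K) * of_real v :: complex))"
        using has_bochner_integral_exp_Iic[of "of_real (Re z + real K)"] assms
        unfolding has_bochner_integral_iff by simp
      show "integrable lborel (\<lambda>v::real. indicator {0<..} v *\<^sub>R exp (of_real (Re z - real m) * of_real v :: complex))"
        using has_bochner_integral_exp_Ioi[of "of_real (Re z - real m)"] m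
        unfolding has_bochner_integral_iff by simp
    qed
    show "AE v in lborel. norm (exp (z * of_real v) * cut K v) \<le> norm (?g v)"
    proof (intro always_eventually allI)
      fix v :: real
      show "norm (exp (z * of_real v) * cut K v) \<le> norm (?g v)"
      proof (cases "v \<le> 0")
        case True
        have "exp (Re z * v) * norm (remainder K v) \<le> exp (Re z * v) * (C * exp (real K * v))"
          using C[OF True] by (intro mult_left_mono) auto
        also have "\<dots> = C * exp ((Re z + real K) * v)" by (simp add: distrib_right exp_add)
        finally show ?thesis using True CD by (simp add: cut_def norm_mult)
      next
        case False
        have "exp (Re z * v) * norm (\<psi> v) \<le> exp (Re z * v) * (D * exp (- (real m * v)))"
          using D[of v] False by (intro mult_left_mono) auto
        also have "\<dots> = D * exp ((Re z - real m) * v)" by (simp add: left_diff_distrib exp_diff exp_minus field_simps)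
        finally show ?thesis using False CD by (simp add: cut_def norm_mult)
      qed
    qed
  qed measurable
qed

lemma holomorphic_continuation_upto:
  assumes A: "A \<subseteq> {z. Re z > - real K}" and b: "b = 0 \<or> 1 \<notin> A"
  shows "continuation_upto K holomorphic_on A"
proof -
  have "(\<lambda>z. LINT v|lborel. exp (z * of_real v) * cut K v) holomorphic_on {z. Re z > - real K}"
  proof -
    have "(\<lambda>z. LINT v|lborel. exp (z * of_real v) * cut K v) field_differentiable (at z)" if z: "Re z > - real K" for z
    proof -
      \<comment> \<open>Halfway between - K and Re z: the strip lemma asks for integrability on both
        edges of an open strip around \<open>z\<close>.\<close>
      define s where "s = (Re z - real K) / 2"
      have s: "s > - real K" "s < Re z" using z by (auto simp: s_def field_simps)
      have "(\<lambda>z. LINT v|lborel. exp (z * of_real v) * cut K v) holomorphic_on {w. s < Re w \<and> Re w < Re z + 1}"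
        by (rule holomorphic_on_laplace_strip) (use integrable_cut[of K] s z in auto)
      moreover have "open {w. s < Re w \<and> Re w < Re z + 1}"
        by (intro open_Collect_conj open_Collect_less continuous_intros)
      ultimately show ?thesis using s by (auto intro: holomorphic_on_imp_differentiable_at)
    qed
    thus ?thesis by (auto simp: holomorphic_on_def intro: field_differentiable_at_within)
  qed
  from holomorphic_on_subset[OF this A] b show ?thesis
    unfolding continuation_upto_def by (cases "b = 0") (auto intro!: holomorphic_intros)
qed

lemma rGamma_divide_shift:
  fixes z :: complex
  assumes "z + of_nat k \<noteq> 0"
  shows "rGamma z * (c / (z + of_nat k)) = c * pochhammer z k * rGamma (z + of_nat k + 1)"
  using pochhammer_rGamma[of z "Suc k"] assms by (simp add: pochhammer_Suc field_simps add_ac)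

text \<open>Raising K moves the term k = K out of the integral over v <= 0. Its transform there is
  a_K / (z + K), which reappears as the new summand.\<close>

lemma continuation_upto_Suc:
  assumes "Re z > - real K"
  shows "continuation_upto (Suc K) z = continuation_upto K z"
proof -
  have pos: "Re (z + of_nat K) > 0" using assms by simp
  hence nz: "z + of_nat K \<noteq> 0" by (metis less_irrefl zero_complex.simps(1))
  have eq: "exp (z * of_real v) * cut (Suc K) v =
      exp (z * of_real v) * cut K v - indicator {..0} v *\<^sub>R (a K * exp ((z + of_nat K) * of_real v))" for v
    by (auto simp: cut_def remainder_def indicator_def exp_add ring_distribs simp flip: exp_of_real)
  have "(LINT v|lborel. exp (z * of_real v) * cut (Suc K) v) =
      (LINT v|lborel. exp (z * of_real v) * cut K v) - a K / (z + of_nat K)"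
    unfolding eq using has_bochner_integral_mult_right[OF has_bochner_integral_exp_Iic[OF pos], of "a K"] integrable_cut[OF assms]
    by (subst Bochner_Integration.integral_diff) (auto simp: has_bochner_integral_iff)
  thus ?thesis
    unfolding continuation_upto_def using rGamma_divide_shift[OF nz, of "a K"]
    by (simp add: right_diff_distrib del: times_divide_eq_right)
qed

lemma continuation_eq:
  assumes "Re z > - real K"
  shows "continuation z = continuation_upto K z"
proof -
  have mono: "continuation_upto (K' + d) z = continuation_upto K' z" if "Re z > - real K'" for K' d
    using that by (induction d) (auto simp: continuation_upto_Suc)
  define K0 where "K0 = nat \<lceil>- Re z\<rceil> + 1"
  have "Re z > - real K0" unfolding K0_def by linarith
  thus ?thesis
    using mono[of K0 "K - K0"] mono[OF assms, of "K0 - K"] unfolding continuation_def K0_def[symmetric]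
    by (cases "K0 \<le> K") auto
qed

text \<open>The choice of K in the definition jumps with \<open>z\<close>, but near a given point
  one fixed K serves, so \<open>continuation\<close> coincides locally with a single
  \<open>continuation_upto K\<close>.\<close>

lemma holomorphic_continuation:
  assumes "b = 0 \<or> 1 \<notin> A"
  shows "continuation holomorphic_on A"
proof -
  have "continuation field_differentiable (at z)" if "b = 0 \<or> z \<noteq> 1" for z
  proof -
    obtain K :: nat where K: "real K > - Re z" using reals_Archimedean2 by blast
    define U where "U = {z. Re z > - real K} - (if b = 0 then {} else {1})"
    have "open {z. Re z > - real K}" by (intro open_Collect_less continuous_intros)
    hence U: "open U" by (auto simp: U_def)
    have "continuation_upto K holomorphic_on U"
      by (rule holomorphic_continuation_upto) (auto simp: U_def)
    hence "continuation holomorphic_on U"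
      by (rule holomorphic_transform) (auto simp: U_def continuation_eq[of K])
    thus ?thesis using U that K
      by (intro holomorphic_on_imp_differentiable_at[of _ U]) (auto simp: U_def)
  qed
  thus ?thesis using assms unfolding holomorphic_on_def
    by (metis field_differentiable_at_within)
qed

lemma
  assumes z: "Re z > 0" "b = 0 \<or> Re z > 1"
  shows integrable_transform: "integrable lborel (\<lambda>v. exp (z * of_real v) * \<psi> v)"
    and continuation_eq_integral: "continuation z = rGamma z * (LINT v|lborel. exp (z * of_real v) * \<psi> v)"
proof -
  have b: "has_bochner_integral lborel (\<lambda>v. b * (indicator {..0} v *\<^sub>R exp ((z - 1) * of_real v))) (b * (1 / (z - 1)))"
  proof (cases "b = 0")
    case False
    thus ?thesis using z(2) by (intro has_bochner_integral_mult_right has_bochner_integral_exp_Iic) auto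
  qed auto
  have eq: "exp (z * of_real v) * \<psi> v =
      exp (z * of_real v) * cut 0 v + b * (indicator {..0} v *\<^sub>R exp ((z - 1) * of_real v))" for v
    by (auto simp: cut_def remainder_def indicator_def exp_diff ring_distribs exp_minus field_simps
         simp flip: exp_of_real)
  have cut: "integrable lborel (\<lambda>v. exp (z * of_real v) * cut 0 v)"
    using integrable_cut[of 0 z] z by simp
  show "integrable lborel (\<lambda>v. exp (z * of_real v) * \<psi> v)"
    unfolding eq using cut b by (auto simp: has_bochner_integral_iff)
  have "(LINT v|lborel. exp (z * of_real v) * \<psi> v) = (LINT v|lborel. exp (z * of_real v) * cut 0 v) + b * (1 / (z - 1))"
    unfolding eq using cut b by (subst Bochner_Integration.integral_add) (auto simp: has_bochner_integral_iff)
  thus "continuation z = rGamma z * (LINT v|lborel. exp (z * of_real v) * \<psi> v)"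
    using z continuation_eq[of 0 z] by (simp add: continuation_upto_def ring_distribs)
qed

text \<open>At z = - k the zero of \<open>rGamma\<close> kills the integral and the term with
  \<open>b\<close>. In the sum over j <= k, the terms with j < k contain \<open>rGamma\<close> at a
  nonpositive integer; for j = k the Pochhammer symbol is (-1)^k k! and \<open>rGamma\<close> is
  taken at 1.\<close>

lemma continuation_minus_of_nat: "continuation (- of_nat k) = (-1) ^ k * fact k * a k"
proof -
  have zero: "rGamma (- of_nat j) = (0::complex)" for j
    by (simp add: rGamma_eq_zero_iff)
  have "(\<Sum>j<Suc k. a j * pochhammer (- of_nat k) j * rGamma (- of_nat k + of_nat j + 1))
       = (\<Sum>j<Suc k. if j = k then (-1) ^ k * fact k * a k else 0)"
  proof (intro sum.cong refl)
    fix j assume j: "j \<in> {..<Suc k}"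
    show "a j * pochhammer (- of_nat k) j * rGamma (- of_nat k + of_nat j + 1) =
            (if j = k then (-1) ^ k * fact k * a k else 0)"
    proof (cases "j = k")
      case True
      thus ?thesis by (simp add: pochhammer_same)
    next
      case False
      hence "- of_nat k + of_nat j + 1 = (- of_nat (k - j - 1) :: complex)" using j
        by (simp add: of_nat_diff)
      thus ?thesis using False zero by simp
    qed
  qed
  thus ?thesis
    using continuation_eq[of "Suc k" "- of_nat k"] by (simp add: continuation_upto_def zero)
qed

text \<open>To the left of its pole, a polar part a_k / (z + k) is minus the integral of a_k exp((z
  + k) v) over v > 0. Hence for Re z < 1 - K all polar parts merge into the integral, and the
  expansion gets subtracted on the entire line. Because a_K = 0, \<open>cut (Suc K)\<close>
  subtracts no more than K terms and convergence extends down to - K - 1.\<close>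

lemma
  assumes aK: "a K = 0" and K: "K \<ge> 1" and z: "- real K - 1 < Re z" "Re z < 1 - real K"
  shows integrable_remainder: "integrable lborel (\<lambda>v. exp (z * of_real v) * remainder K v)"
    and continuation_eq_remainder: "continuation z = rGamma z * (LINT v|lborel. exp (z * of_real v) * remainder K v)"
proof -
  have b: "has_bochner_integral lborel (\<lambda>v. b * (indicator {0<..} v *\<^sub>R exp ((z - 1) * of_real v))) (b * (- 1 / (z - 1)))"
    using z K by (intro has_bochner_integral_mult_right has_bochner_integral_exp_Ioi) auto
  have k: "has_bochner_integral lborel (\<lambda>v. \<Sum>k<K. a k * (indicator {0<..} v *\<^sub>R exp ((z + of_nat k) * of_real v)))
      (\<Sum>k<K. a k * (- 1 / (z + of_nat k)))"
    using z by (intro has_bochner_integral_sum has_bochner_integral_mult_right has_bochner_integral_exp_Ioi) auto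
  have eq: "exp (z * of_real v) * remainder K v =
      exp (z * of_real v) * cut (Suc K) v - b * (indicator {0<..} v *\<^sub>R exp ((z - 1) * of_real v))
       - (\<Sum>k<K. a k * (indicator {0<..} v *\<^sub>R exp ((z + of_nat k) * of_real v)))" for v
    by (auto simp: cut_def remainder_def aK exp_diff exp_add ring_distribs sum_distrib_left exp_minus mult_ac
         simp flip: exp_of_real intro!: sum.cong) (auto simp: field_simps lessThan_def)
  have cut: "integrable lborel (\<lambda>v. exp (z * of_real v) * cut (Suc K) v)"
    using integrable_cut[of "Suc K" z] z by simp
  show "integrable lborel (\<lambda>v. exp (z * of_real v) * remainder K v)"
    unfolding eq using cut b k by (auto simp: has_bochner_integral_iff)
  have int: "(LINT v|lborel. exp (z * of_real v) * remainder K v) = (LINT v|lborel. exp (z * of_real v) * cut (Suc K) v)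
        - b * (- 1 / (z - 1)) - (\<Sum>k<K. a k * (- 1 / (z + of_nat k)))"
    unfolding eq using cut b k
    by (subst Bochner_Integration.integral_diff; (subst Bochner_Integration.integral_diff)?)
       (auto simp: has_bochner_integral_iff)
  have "rGamma z * (\<Sum>k<K. a k * (- 1 / (z + of_nat k))) = - (\<Sum>k<K. a k * pochhammer z k * rGamma (z + of_nat k + 1))"
    unfolding sum_distrib_left sum_negf[symmetric]
  proof (intro sum.cong refl)
    fix k assume "k \<in> {..<K}"
    hence "Re (z + of_nat k) < 0" using z by auto
    hence "z + of_nat k \<noteq> 0" by (metis less_irrefl zero_complex.simps(1))
    from rGamma_divide_shift[OF this, of "a k"]
    show "rGamma z * (a k * (- 1 / (z + of_nat k))) = - (a k * pochhammer z k * rGamma (z + of_nat k + 1))"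
      by simp
  qed
  thus "continuation z = rGamma z * (LINT v|lborel. exp (z * of_real v) * remainder K v)"
    using continuation_eq[of "Suc K" z] z aK unfolding int
    by (simp add: continuation_upto_def ring_distribs mult_ac)
qed

text \<open>Supplies the boundedness that \<open>fourier_inversion\<close> requires on the line Re z
  = - K. For v >= 0 every term of the remainder is at most a constant times exp(K v).\<close>

lemma bounded_remainder:
  assumes aK: "a K = 0"
  shows "\<exists>B. \<forall>v. norm (exp (of_real (- real K * v)) * remainder K v) \<le> B"
proof -
  obtain C where C: "\<And>v. v \<le> 0 \<Longrightarrow> norm (remainder K v) \<le> C * exp (real K * v)"
    using expansion[of K] unfolding remainder_def by blast
  obtain D where D: "\<And>v. v \<ge> 0 \<Longrightarrow> norm (\<psi> v) \<le> D"
    using decay[of 0] by auto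
  have "norm (exp (of_real (- real K * v)) * remainder K v) \<le> \<bar>C\<bar> + (D + norm b + (\<Sum>k<K. norm (a k)))" for v
  proof (cases "v \<le> 0")
    case True
    have "exp (- real K * v) * norm (remainder K v) \<le> exp (- real K * v) * (C * exp (real K * v))"
      using C[OF True] by (intro mult_left_mono) auto
    also have "\<dots> = C" by (simp add: exp_minus)
    finally have "norm (exp (of_real (- real K * v)) * remainder K v) \<le> \<bar>C\<bar>"
      by (simp add: norm_mult)
    moreover have "0 \<le> D" using D[of 0] norm_ge_zero[of "\<psi> 0"] by linarith
    moreover have "0 \<le> (\<Sum>k<K. norm (a k))" by (intro sum_nonneg) auto
    ultimately show ?thesis using norm_ge_zero[of b] by linarith
  next
    case False
    hence v: "v \<ge> 0" by simp
    have "norm (remainder K v) \<le> norm (\<psi> v) + norm (b * of_real (exp (- v))) + norm (\<Sum>k<K. a k * of_real (exp (real k * v)))"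
      unfolding remainder_def by (intro order_trans[OF norm_triangle_ineq4] add_mono norm_triangle_ineq4 order_refl)
    also have "\<dots> \<le> D * exp (real K * v) + norm b * exp (real K * v) + (\<Sum>k<K. norm (a k) * exp (real K * v))"
    proof (intro add_mono sum_norm_le)
      show "norm (\<psi> v) \<le> D * exp (real K * v)"
      proof -
        have "D \<ge> 0" using D[of 0] norm_ge_zero[of "\<psi> 0"] by linarith
        hence "D * 1 \<le> D * exp (real K * v)" using v by (intro mult_left_mono) auto
        thus ?thesis using D[OF v] by linarith
      qed
      show "norm (b * of_real (exp (- v))) \<le> norm b * exp (real K * v)"
      proof -
        have "0 \<le> real K * v" using v by simp
        hence "- v \<le> real K * v" using v by linarith
        hence "exp (- v) \<le> exp (real K * v)" by (simp only: exp_le_cancel_iff)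
        thus ?thesis by (simp add: norm_mult mult_left_mono)
      qed
      show "norm (a k * of_real (exp (real k * v))) \<le> norm (a k) * exp (real K * v)" if "k \<in> {..<K}" for k
      proof -
        have "exp (real k * v) \<le> exp (real K * v)" using v that by (simp add: mult_right_mono)
        thus ?thesis by (simp add: norm_mult mult_left_mono)
      qed
    qed
    also have "\<dots> = (D + norm b + (\<Sum>k<K. norm (a k))) * exp (real K * v)"
      by (simp add: distrib_right sum_distrib_right)
    finally have "exp (- real K * v) * norm (remainder K v) \<le> exp (- real K * v) * \<dots>"
      by (intro mult_left_mono) auto
    also have "\<dots> = D + norm b + (\<Sum>k<K. norm (a k))" by (simp add: exp_minus)
    finally show ?thesis by (simp add: norm_mult)
  qed
  thus ?thesis by blast
qed

end

section \<open>Schwartz functions on the negative half-line\<close>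

text \<open>A function on the negative half-line together with a chosen sequence of its derivatives.\<close>

definition schwartz_seq :: "(nat \<Rightarrow> real \<Rightarrow> complex) \<Rightarrow> bool" where
  "schwartz_seq e \<longleftrightarrow>
     (\<forall>n. \<forall>t\<le>0. (e n has_vector_derivative e (Suc n) t) (at t within {..0})) \<and>
     (\<forall>n m. \<exists>C. \<forall>t\<le>0. (1 - t) ^ m * norm (e n t) \<le> C)"

lemma schwartz_seqD:
  assumes "schwartz_seq e" "t \<le> 0"
  shows "(e n has_vector_derivative e (Suc n) t) (at t within {..0})"
  using assms by (auto simp: schwartz_seq_def)

lemma schwartz_seq_bound:
  assumes "schwartz_seq e"
  shows "\<exists>C\<ge>0. \<forall>t\<le>0. norm (e n t) \<le> C / (1 - t) ^ m"
proof -
  obtain C where C: "\<And>t. t \<le> 0 \<Longrightarrow> (1 - t) ^ m * norm (e n t) \<le> C"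
    using assms unfolding schwartz_seq_def by blast
  have "norm (e n 0) \<le> C" using C[of 0] by simp
  hence "C \<ge> 0" using norm_ge_zero order_trans by blast
  moreover have "norm (e n t) \<le> C / (1 - t) ^ m" if "t \<le> 0" for t
    using C[OF that] that by (simp add: pos_le_divide_eq mult.commute)
  ultimately show ?thesis by blast
qed

lemma continuous_on_schwartz_seq: "schwartz_seq e \<Longrightarrow> continuous_on {..0} (e n)"
  unfolding continuous_on_eq_continuous_within
  using schwartz_seqD has_vector_derivative_continuous by fastforce

lemma schwartz_seq_shift: "schwartz_seq e \<Longrightarrow> schwartz_seq (\<lambda>n. e (n + k))"
  by (auto simp: schwartz_seq_def)

lemma schwartz_seq_left_deriv:
  assumes "schwartz_left F"
  shows "schwartz_seq (\<lambda>n. left_deriv n F)"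
  unfolding schwartz_seq_def
proof (intro conjI allI impI)
  fix n and t :: real assume "t \<le> 0"
  thus "(left_deriv n F has_vector_derivative left_deriv (Suc n) F t) (at t within {..0})"
    using assms by (simp add: schwartz_left_def differentiable_on_def vector_derivative_works[symmetric])
next
  fix n m :: nat
  have cont: "continuous_on {..0} (left_deriv n F)"
    using assms by (simp add: schwartz_left_def differentiable_imp_continuous_on)
  have "((\<lambda>t. of_real (\<bar>t\<bar> ^ m) * left_deriv n F t) \<longlongrightarrow> 0) at_bot"
    using assms by (simp add: schwartz_left_def)
  hence "eventually (\<lambda>t. norm (of_real (\<bar>t\<bar> ^ m) * left_deriv n F t) < 1) at_bot"
    using order_tendstoD(2)[OF tendsto_norm_zero, of _ at_bot 1] by simp
  then obtain T where T: "\<And>t. t \<le> T \<Longrightarrow> norm (of_real (\<bar>t\<bar> ^ m) * left_deriv n F t) < 1"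
    unfolding eventually_at_bot_linorder by blast
  \<comment> \<open>For t <= -1 one has 1 - t <= 2 |t|, which costs the factor 2^m; the rest of the
    half-line is compact.\<close>
  define T' where "T' = min T (-1)"
  let ?h = "\<lambda>t. (1 - t) ^ m * norm (left_deriv n F t)"
  have "compact (?h ` {T'..0})"
    by (intro compact_continuous_image continuous_intros continuous_on_subset[OF cont]) auto
  hence "bdd_above (?h ` {T'..0})" by (intro bounded_imp_bdd_above compact_imp_bounded)
  then obtain C where "\<forall>y\<in>?h ` {T'..0}. y \<le> C" unfolding bdd_above_def by blast
  hence C: "?h t \<le> C" if "t \<in> {T'..0}" for t using that by blast
  have "?h t \<le> max C (2 ^ m)" if "t \<le> 0" for t
  proof (cases "t \<ge> T'")
    case True
    thus ?thesis using C[of t] that by (auto simp: le_max_iff_disj)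
  next
    case False
    hence t: "t \<le> T" "t \<le> -1" by (auto simp: T'_def)
    have "?h t \<le> (2 * \<bar>t\<bar>) ^ m * norm (left_deriv n F t)"
      using t by (intro mult_right_mono power_mono) auto
    also have "\<dots> = 2 ^ m * norm (of_real (\<bar>t\<bar> ^ m) * left_deriv n F t)"
      by (simp add: norm_mult power_mult_distrib norm_power)
    also have "\<dots> \<le> 2 ^ m * 1" using T[OF t(1)] by (intro mult_left_mono) auto
    finally show ?thesis by simp
  qed
  thus "\<exists>C. \<forall>t\<le>0. ?h t \<le> C" by blast
qed

text \<open>The derivatives of \<open>t * F' t\<close>.\<close>

lemma schwartz_seq_euler:
  assumes "schwartz_seq e"
  shows "schwartz_seq (\<lambda>n t. of_real t * e (Suc n) t + of_nat n * e n t)"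
  unfolding schwartz_seq_def
proof (intro conjI allI impI)
  fix n and t :: real assume t: "t \<le> 0"
  show "((\<lambda>t. of_real t * e (Suc n) t + of_nat n * e n t) has_vector_derivative
          of_real t * e (Suc (Suc n)) t + of_nat (Suc n) * e (Suc n) t) (at t within {..0})"
  proof -
    have "((\<lambda>t. of_real t * e (Suc n) t + of_nat n * e n t) has_vector_derivative
            (of_real t * e (Suc (Suc n)) t + of_real 1 * e (Suc n) t) + of_nat n * e (Suc n) t) (at t within {..0})"
      by (rule has_vector_derivative_add[OF has_vector_derivative_mult[OF
            has_vector_derivative_of_real[OF DERIV_ident] schwartz_seqD[OF assms t]]
            has_vector_derivative_mult_right[OF schwartz_seqD[OF assms t]]])
    thus ?thesis by (simp add: algebra_simps)
  qed
next
  fix n m :: nat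
  \<comment> \<open>One extra power of decay pays for the factor \<open>t\<close>.\<close>
  obtain C where C: "C \<ge> 0" "\<And>t. t \<le> 0 \<Longrightarrow> norm (e (Suc n) t) \<le> C / (1 - t) ^ Suc m"
    using schwartz_seq_bound[OF assms, of "Suc n" "Suc m"] by blast
  obtain D where D: "D \<ge> 0" "\<And>t. t \<le> 0 \<Longrightarrow> norm (e n t) \<le> D / (1 - t) ^ m"
    using schwartz_seq_bound[OF assms, of n m] by blast
  have "(1 - t) ^ m * norm (of_real t * e (Suc n) t + of_nat n * e n t) \<le> C + real n * D" if t: "t \<le> 0" for t
  proof -
    have "norm (of_real t * e (Suc n) t + of_nat n * e n t) \<le> norm (of_real t * e (Suc n) t) + norm (of_nat n * e n t)"
      by (rule norm_triangle_ineq)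
    also have "\<dots> \<le> (1 - t) * (C / (1 - t) ^ Suc m) + real n * (D / (1 - t) ^ m)"
      unfolding norm_mult using t by (intro add_mono mult_mono C(2) D(2)) auto
    also have "\<dots> = (C + real n * D) / (1 - t) ^ m"
      using t by (simp add: field_simps)
    finally show ?thesis using t by (simp add: pos_le_divide_eq mult.commute)
  qed
  thus "\<exists>C. \<forall>t\<le>0. (1 - t) ^ m * norm (of_real t * e (Suc n) t + of_nat n * e n t) \<le> C" by blast
qed

lemma power_le_exp:
  fixes x :: real
  assumes "x \<ge> 0"
  shows "x ^ m \<le> real m ^ m * exp x"
proof (cases "m = 0")
  case False
  have "(x / real m) ^ m \<le> exp (x / real m) ^ m"
    using assms exp_ge_add_one_self[of "x / real m"] by (intro power_mono) (linarith, auto)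
  also have "\<dots> = exp x" using False by (simp flip: exp_of_nat_mult)
  finally show ?thesis using False by (simp add: power_divide field_simps)
qed (use assms in auto)

lemma schwartz_seq_exp: "schwartz_seq (\<lambda>n t. of_real (exp t))"
  unfolding schwartz_seq_def
proof (intro conjI allI impI)
  fix t :: real
  show "((\<lambda>t. of_real (exp t) :: complex) has_vector_derivative of_real (exp t)) (at t within {..0})"
    by (intro has_vector_derivative_of_real has_field_derivative_at_within[OF DERIV_exp])
next
  fix n m :: nat
  have "(1 - t) ^ m * norm (of_real (exp t) :: complex) \<le> real m ^ m * exp 1" if "t \<le> 0" for t
    using mult_right_mono[OF power_le_exp[of "1 - t" m], of "exp t"] that
    by (simp add: exp_diff)
  thus "\<exists>C. \<forall>t\<le>0. (1 - t) ^ m * norm (of_real (exp t) :: complex) \<le> C" by blast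
qed

text \<open>Taylor's theorem for the real and the imaginary part separately, whence the constant 2.
  The factorial in the remainder is simply estimated by 1.\<close>

lemma complex_valued_Taylor:
  fixes D :: "nat \<Rightarrow> real \<Rightarrow> complex"
  assumes S: "convex S"
    and D: "\<And>i x. x \<in> S \<Longrightarrow> i \<le> n \<Longrightarrow> (D i has_vector_derivative D (Suc i) x) (at x within S)"
    and B: "\<And>x. x \<in> S \<Longrightarrow> norm (D (Suc n) x) \<le> B"
    and wz: "w \<in> S" "z \<in> S"
  shows "norm (D 0 z - (\<Sum>i\<le>n. D i w * of_real ((z - w) ^ i / fact i))) \<le> 2 * B * \<bar>z - w\<bar> ^ Suc n"
proof -
  have B0: "B \<ge> 0" using B[OF wz(1)] norm_ge_zero order_trans by blast
  have *: "\<bar>L (D 0 z - (\<Sum>i\<le>n. D i w * of_real ((z - w) ^ i / fact i)))\<bar> \<le> B * \<bar>z - w\<bar> ^ Suc n"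
    if L: "bounded_linear L" and le: "\<And>u. \<bar>L u\<bar> \<le> norm u" for L :: "complex \<Rightarrow> real"
  proof -
    interpret bounded_linear L by fact
    have "\<bar>L (D 0 z) - (\<Sum>i\<le>n. L (D i w) * (z - w) ^ i / fact i)\<bar> \<le> B * \<bar>z - w\<bar> ^ Suc n / fact n"
      unfolding real_norm_def[symmetric]
    proof (rule field_Taylor[of S n "\<lambda>i x. L (D i x)"])
      show "(((\<lambda>x. L (D i x)) has_field_derivative L (D (Suc i) x)) (at x within S))"
        if "x \<in> S" "i \<le> n" for i x
        unfolding has_real_derivative_iff_has_vector_derivative
        by (rule has_vector_derivative D that)+
      show "norm (L (D (Suc n) x)) \<le> B" if "x \<in> S" for x
        unfolding real_norm_def using le B[OF that] order_trans by blast
    qed (use S wz in auto)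
    also have "\<dots> \<le> B * \<bar>z - w\<bar> ^ Suc n / 1"
      using B0 by (intro divide_left_mono) (auto simp: fact_ge_1)
    finally show ?thesis
    proof -
      have "D i w * of_real ((z - w) ^ i / fact i) = ((z - w) ^ i / fact i) *\<^sub>R D i w" for i
        by (simp add: scaleR_conv_of_real)
      moreover assume "\<bar>L (D 0 z) - (\<Sum>i\<le>n. L (D i w) * (z - w) ^ i / fact i)\<bar> \<le> B * \<bar>z - w\<bar> ^ Suc n / 1"
      ultimately show ?thesis by (simp add: diff sum scaleR mult.commute)
    qed
  qed
  show ?thesis
    using *[OF bounded_linear_Re abs_Re_le_cmod] *[OF bounded_linear_Im abs_Im_le_cmod]
      cmod_le[of "D 0 z - (\<Sum>i\<le>n. D i w * of_real ((z - w) ^ i / fact i))"]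
    by linarith
qed

lemma schwartz_seq_Taylor_0:
  assumes "schwartz_seq e"
  shows "\<exists>C. \<forall>x. 0 \<le> x \<longrightarrow> norm (e 0 (-x) - (\<Sum>k<K. (-1) ^ k / fact k * e k 0 * of_real x ^ k)) \<le> C * x ^ K"
proof -
  obtain C where C: "\<And>t. t \<le> 0 \<Longrightarrow> norm (e K t) \<le> C / (1 - t) ^ 0"
    using schwartz_seq_bound[OF assms, of K 0] by blast
  show ?thesis
  proof (cases K)
    case 0
    thus ?thesis using C by (intro exI[of _ C]) auto
  next
    case (Suc n)
    have "norm (e 0 (-x) - (\<Sum>k<K. (-1) ^ k / fact k * e k 0 * of_real x ^ k)) \<le> 2 * C * x ^ K" if "x \<ge> 0" for x
    proof -
      have "norm (e 0 (-x) - (\<Sum>i\<le>n. e i 0 * of_real ((-x - 0) ^ i / fact i))) \<le> 2 * C * \<bar>-x - 0\<bar> ^ Suc n"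
        by (rule complex_valued_Taylor[of "{..0}"])
           (use that C Suc schwartz_seqD[OF assms] in auto)
      also have "(\<Sum>i\<le>n. e i 0 * of_real ((-x - 0) ^ i / fact i)) = (\<Sum>k<K. (-1) ^ k / fact k * e k 0 * of_real x ^ k)"
        unfolding Suc lessThan_Suc_atMost
      proof (rule sum.cong[OF refl])
        fix i
        have "(- complex_of_real x) ^ i = (-1) ^ i * of_real x ^ i" by (rule power_minus)
        thus "e i 0 * of_real ((-x - 0) ^ i / fact i) = (-1) ^ i / fact i * e i 0 * of_real x ^ i" by simp
      qed
      finally show ?thesis using that Suc by simp
    qed
    thus ?thesis by blast
  qed
qed

text \<open>There is no 1 / x term, so the continuation is entire; with these coefficients
  \<open>continuation_minus_of_nat\<close> gives it the value \<open>e k 0\<close> at - k, the usual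
  derivative.\<close>

lemma laplace_expansion_schwartz:
  assumes e: "schwartz_seq e"
  shows "laplace_expansion (\<lambda>v. e 0 (- exp v)) 0 (\<lambda>k. (-1) ^ k / fact k * e k 0)"
proof
  show "continuous_on UNIV (\<lambda>v. e 0 (- exp v))"
    by (intro continuous_on_compose2[OF continuous_on_schwartz_seq[OF e]] continuous_intros) auto
next
  fix K
  obtain C where C: "\<And>x. 0 \<le> x \<Longrightarrow> norm (e 0 (-x) - (\<Sum>k<K. (-1) ^ k / fact k * e k 0 * of_real x ^ k)) \<le> C * x ^ K"
    using schwartz_seq_Taylor_0[OF e, of K] by blast
  have "norm (e 0 (- exp v) - 0 * of_real (exp (- v)) - (\<Sum>k<K. (-1) ^ k / fact k * e k 0 * of_real (exp (real k * v))))
              \<le> C * exp (real K * v)" for v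
    using C[of "exp v"] by (simp add: exp_of_nat_mult)
  thus "\<exists>C. \<forall>v\<le>0. norm (e 0 (- exp v) - 0 * of_real (exp (- v)) - (\<Sum>k<K. (-1) ^ k / fact k * e k 0 * of_real (exp (real k * v))))
              \<le> C * exp (real K * v)" by blast
next
  fix m
  obtain C where C: "C \<ge> 0" "\<And>t. t \<le> 0 \<Longrightarrow> norm (e 0 t) \<le> C / (1 - t) ^ m"
    using schwartz_seq_bound[OF e, of 0 m] by blast
  have "norm (e 0 (- exp v)) \<le> C * exp (- (real m * v))" for v
  proof -
    have "norm (e 0 (- exp v)) \<le> C / (1 - (- exp v)) ^ m" by (intro C) auto
    also have "\<dots> \<le> C / exp v ^ m"
      using C by (intro divide_left_mono power_mono mult_pos_pos zero_less_power) (auto intro!: add_pos_pos)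
    also have "\<dots> = C * exp (- (real m * v))" unfolding exp_minus exp_of_nat_mult by (simp add: divide_inverse)
    finally show ?thesis .
  qed
  thus "\<exists>C. \<forall>v\<ge>0. norm (e 0 (- exp v)) \<le> C * exp (- (real m * v))" by blast
qed

section \<open>Antiderivatives vanishing at minus infinity\<close>

lemma schwartz_seq_tendsto_at_bot:
  assumes e: "schwartz_seq e"
  shows "(e n \<longlongrightarrow> 0) at_bot"
proof -
  obtain C where C: "\<And>t. t \<le> 0 \<Longrightarrow> norm (e n t) \<le> C / (1 - t) ^ 1"
    using schwartz_seq_bound[OF e, of n 1] by blast
  have "((\<lambda>t. C / (1 - t) ^ 1) \<longlongrightarrow> 0) at_bot" by real_asymp
  moreover have "eventually (\<lambda>t. norm (e n t) \<le> C / (1 - t) ^ 1) at_bot"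
    using eventually_le_at_bot[of "0::real"] by eventually_elim (rule C)
  ultimately show ?thesis by (rule Lim_null_comparison[rotated])
qed

text \<open>The normalisation at minus infinity makes the telescoping sum in the Euler-Maclaurin
  argument end in \<open>A 0\<close> alone. That value is written in the variable v because it will
  be the coefficient \<open>b\<close> of the 1 / x term and is the transform at z = 1.\<close>

lemma schwartz_seq_antiderivative:
  assumes e: "schwartz_seq e"
  shows "\<exists>A. (\<forall>t\<le>0. (A has_vector_derivative e 0 t) (at t within {..0})) \<and>
             A 0 = (LINT v|lborel. exp (of_real v) * e 0 (- exp v)) \<and> (A \<longlongrightarrow> 0) at_bot"
proof -
  interpret laplace_expansion "\<lambda>v. e 0 (- exp v)" 0 "\<lambda>k. (-1) ^ k / fact k * e k 0"
    by (rule laplace_expansion_schwartz[OF e])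
  let ?f = "\<lambda>v. exp (of_real v) * e 0 (- exp v)"
  have int: "integrable lborel ?f" using integrable_transform[of 1] by simp
  define P where "P t = integral {t..0} (e 0)" for t
  have contA: "continuous_on A (e 0)" if "A \<subseteq> {..0}" for A
    using continuous_on_subset[OF continuous_on_schwartz_seq[OF e] that] .
  have P': "((\<lambda>t. - P t) has_vector_derivative e 0 t) (at t within {..0})" if t: "t \<le> 0" for t
  proof -
    have "((\<lambda>u. integral {t-1..u} (e 0)) has_vector_derivative e 0 t) (at t within {t-1..0})"
      using t by (intro integral_has_vector_derivative contA) auto
    hence d: "((\<lambda>u. integral {t-1..u} (e 0) - integral {t-1..0} (e 0)) has_vector_derivative e 0 t - 0) (at t within {t-1..0})"
      by (intro has_vector_derivative_diff has_vector_derivative_const)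
    have P: "- P u = integral {t-1..u} (e 0) - integral {t-1..0} (e 0)" if "u \<in> {t-1..0}" for u
    proof -
      have "integral {t-1..u} (e 0) + integral {u..0} (e 0) = integral {t-1..0} (e 0)"
        using that t by (intro Henstock_Kurzweil_Integration.integral_combine integrable_continuous_real contA) auto
      thus ?thesis by (simp add: P_def algebra_simps)
    qed
    have "((\<lambda>t. - P t) has_vector_derivative e 0 t - 0) (at t within {t-1..0})"
      by (rule has_vector_derivative_transform[OF _ P d]) (use t in auto)
    moreover have "at t within {t-1..0} = at t within {..0}"
      by (rule at_within_nhd[of _ "{t-1<..}"]) auto
    ultimately show ?thesis by simp
  qed
  have contP: "continuous_on {..0} P"
  proof -
    have "continuous_on {..0} (\<lambda>t. - (- P t))"
      by (intro continuous_on_minus continuous_on_vector_derivative[of _ _ "e 0"]) (use P' in auto)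
    thus ?thesis by simp
  qed
  \<comment> \<open>The fundamental theorem of calculus in the variable v, where t = - exp v; the
    lower limit v = minus infinity corresponds to t = 0.\<close>
  have fin: "(LINT v|lborel. indicator {..w} v *\<^sub>R ?f v) = P (- exp w)" for w
  proof -
    let ?G = "\<lambda>v. P (- exp v)"
    have contG: "continuous_on UNIV ?G"
      by (intro continuous_on_compose2[OF contP] continuous_intros) auto
    have "(LBINT v=-\<infinity>..ereal w. ?f v) = ?G w - P 0"
    proof (rule interval_integral_FTC_integrable[where F = ?G])
      fix v :: real
      have "at (- exp v) within {..0} = at (- exp v)" by (rule at_within_interior) simp
      moreover have "- exp v \<le> 0" by simp
      ultimately have "((\<lambda>t. - P t) has_vector_derivative e 0 (- exp v)) (at (- exp v))"
        using P'[of "- exp v"] by metis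
      moreover have "((\<lambda>v. - exp v) has_vector_derivative - exp v) (at v)"
        by (intro has_vector_derivative_minus has_real_derivative_iff_has_vector_derivative[THEN iffD1, OF DERIV_exp])
      ultimately have "((\<lambda>t. - P t) \<circ> (\<lambda>v. - exp v) has_vector_derivative - exp v *\<^sub>R e 0 (- exp v)) (at v)"
        by (intro vector_diff_chain_at)
      from has_vector_derivative_minus[OF this]
      show "(?G has_vector_derivative ?f v) (at v)"
        by (simp add: comp_def scaleR_conv_of_real exp_of_real)
      have "continuous_on UNIV ?f"
        using cont by (intro continuous_on_mult) (auto intro!: continuous_intros)
      thus "isCont ?f v" by (simp add: continuous_on_eq_continuous_at)
    next
      show "set_integrable lborel (einterval (-\<infinity>) (ereal w)) ?f"
        unfolding set_integrable_def using int by (intro integrable_mult_indicator) auto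
      have "isCont ?G w" using contG by (simp add: continuous_on_eq_continuous_at)
      hence "(?G \<longlongrightarrow> ?G w) (at_left w)"
        unfolding isCont_def by (rule tendsto_within_subset) auto
      thus "((?G \<circ> real_of_ereal) \<longlongrightarrow> ?G w) (at_left (ereal w))"
        by (simp only: ereal_tendsto_simps)
      have "filterlim (\<lambda>v::real. - exp v) (at 0 within {..0}) at_bot"
        unfolding filterlim_at using tendsto_minus[OF exp_at_bot] by auto
      hence "(?G \<longlongrightarrow> P 0) at_bot"
        using contP filterlim_compose[of P "nhds (P 0)" "at 0 within {..0}"]
        by (auto simp: continuous_on_def)
      thus "((?G \<circ> real_of_ereal) \<longlongrightarrow> P 0) (at_right (-\<infinity>))"
        by (simp only: ereal_tendsto_simps)
    qed auto
    moreover have "P 0 = 0" by (simp add: P_def)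
    moreover have "(LBINT v=-\<infinity>..ereal w. ?f v) = (LINT v|lborel. indicator {..<w} v *\<^sub>R ?f v)"
      by (simp add: interval_lebesgue_integral_def set_lebesgue_integral_def einterval_def lessThan_def)
    moreover have "\<dots> = (LINT v|lborel. indicator {..w} v *\<^sub>R ?f v)"
      by (rule integral_discrete_difference[of "{w}"]) (auto simp: indicator_def)
    ultimately show ?thesis by simp
  qed
  define I where "I = integral\<^sup>L lborel ?f"
  have lim: "((\<lambda>w. P (- exp w)) \<longlongrightarrow> I) at_top"
    using tendsto_integral_at_top[of lborel ?f] int by (simp add: fin I_def)
  have "filterlim (\<lambda>t::real. ln (- t)) at_top at_bot" by real_asymp
  hence "((\<lambda>t. P (- exp (ln (- t)))) \<longlongrightarrow> I) at_bot"
    by (rule filterlim_compose[OF lim])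
  moreover have "eventually (\<lambda>t. P (- exp (ln (- t))) = P t) at_bot"
    using eventually_gt_at_bot[of "0::real"]
    by eventually_elim simp
  ultimately have limP: "(P \<longlongrightarrow> I) at_bot"
    by (rule Lim_transform_eventually)
  show ?thesis
  proof (intro exI[of _ "\<lambda>t. I - P t"] conjI allI impI)
    fix t :: real assume "t \<le> 0"
    from has_vector_derivative_add[OF has_vector_derivative_const P'[OF this], of I]
    show "((\<lambda>t. I - P t) has_vector_derivative e 0 t) (at t within {..0})" by simp
  next
    show "I - P 0 = integral\<^sup>L lborel ?f" by (simp add: I_def P_def)
    show "((\<lambda>t. I - P t) \<longlongrightarrow> 0) at_bot"
      using tendsto_diff[OF tendsto_const limP, of I] by simp
  qed
qed

section \<open>Convergence, decay and continuity of lattice sums\<close>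

definition lattice_sum :: "(real \<Rightarrow> complex) \<Rightarrow> real \<Rightarrow> complex" where
  "lattice_sum f x = (\<Sum>n. f (- (real (Suc n) * x)))"

text \<open>Of the m + 2 powers of decay, two make the sum over n converge; in x all m + 2
  survive.\<close>

lemma schwartz_seq_lattice_bound:
  assumes e: "schwartz_seq e"
  shows "\<exists>C\<ge>0. \<forall>x>0. \<forall>n. norm (e i (- (real (Suc n) * x))) \<le> C / x ^ (m + 2) * inverse (real (Suc n) ^ 2)"
proof -
  obtain C where C: "C \<ge> 0" "\<And>t. t \<le> 0 \<Longrightarrow> norm (e i t) \<le> C / (1 - t) ^ (m + 2)"
    using schwartz_seq_bound[OF e, of i "m + 2"] by blast
  have "norm (e i (- (real (Suc n) * x))) \<le> C / x ^ (m + 2) * inverse (real (Suc n) ^ 2)" if x: "x > 0" for x n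
  proof -
    have "real (Suc n) ^ 2 * x ^ (m + 2) \<le> real (Suc n) ^ (m + 2) * x ^ (m + 2)"
      using x by (intro mult_right_mono power_increasing) auto
    also have "\<dots> = (real (Suc n) * x) ^ (m + 2)" by (simp only: power_mult_distrib)
    also have "\<dots> \<le> (1 - - (real (Suc n) * x)) ^ (m + 2)"
      using x by (intro power_mono) auto
    finally have le: "real (Suc n) ^ 2 * x ^ (m + 2) \<le> (1 - - (real (Suc n) * x)) ^ (m + 2)" .
    have pos: "0 < real (Suc n) ^ 2 * x ^ (m + 2)"
      using x by (intro mult_pos_pos zero_less_power) auto
    have "norm (e i (- (real (Suc n) * x))) \<le> C / (1 - - (real (Suc n) * x)) ^ (m + 2)"
      using x by (intro C) auto
    also have "\<dots> \<le> C / (real (Suc n) ^ 2 * x ^ (m + 2))"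
      using le pos C(1) less_le_trans[OF pos le] 
      by (metis divide_left_mono mult_pos_pos)
    finally show ?thesis by (simp add: divide_inverse mult_ac)
  qed
  thus ?thesis using C(1) by blast
qed

lemma summable_inverse_Suc_squares: "summable (\<lambda>n. inverse (real (Suc n) ^ 2))"
  using inverse_power_summable[of 2, where 'a = real] by (subst summable_Suc_iff) simp

lemma summable_lattice:
  assumes e: "schwartz_seq e" and x: "x > 0"
  shows "summable (\<lambda>n. e i (- (real (Suc n) * x)))"
proof -
  obtain C where C: "\<And>n. norm (e i (- (real (Suc n) * x))) \<le> C / x ^ (0 + 2) * inverse (real (Suc n) ^ 2)"
    using schwartz_seq_lattice_bound[OF e, of i 0] x by blast
  show ?thesis
    by (rule summable_comparison_test'[OF summable_mult[OF summable_inverse_Suc_squares] C])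
qed

lemma lattice_sum_decay:
  assumes e: "schwartz_seq e"
  shows "\<exists>C. \<forall>x\<ge>1. norm (lattice_sum (e i) x) \<le> C / x ^ m"
proof -
  obtain C where C: "C \<ge> 0" "\<And>x n. x > 0 \<Longrightarrow> norm (e i (- (real (Suc n) * x))) \<le> C / x ^ (m + 2) * inverse (real (Suc n) ^ 2)"
    using schwartz_seq_lattice_bound[OF e, of i m] by blast
  define Z where "Z = (\<Sum>n. inverse (real (Suc n) ^ 2))"
  have "Z \<ge> 0" unfolding Z_def by (intro suminf_nonneg summable_inverse_Suc_squares) auto
  have "norm (lattice_sum (e i) x) \<le> C * Z / x ^ m" if x: "x \<ge> 1" for x
  proof -
    have "norm (lattice_sum (e i) x) \<le> (\<Sum>n. C / x ^ (m + 2) * inverse (real (Suc n) ^ 2))"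
      unfolding lattice_sum_def
      by (intro norm_suminf_le C summable_mult summable_inverse_Suc_squares) (use x in auto)
    also have "\<dots> = C * Z / x ^ (m + 2)"
      unfolding Z_def by (subst suminf_mult[OF summable_inverse_Suc_squares]) simp
    also have "\<dots> \<le> C * Z / x ^ m"
      using x C(1) \<open>Z \<ge> 0\<close> by (intro divide_left_mono power_increasing mult_nonneg_nonneg mult_pos_pos) auto
    finally show ?thesis .
  qed
  thus ?thesis by blast
qed

lemma continuous_on_lattice_sum_exp:
  assumes e: "schwartz_seq e"
  shows "continuous_on UNIV (\<lambda>v. lattice_sum (e i) (exp v))"
proof -
  obtain C where C: "C \<ge> 0" "\<And>x n. x > 0 \<Longrightarrow> norm (e i (- (real (Suc n) * x))) \<le> C / x ^ (0 + 2) * inverse (real (Suc n) ^ 2)"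
    using schwartz_seq_lattice_bound[OF e, of i 0] by blast
  have "isCont (\<lambda>v. lattice_sum (e i) (exp v)) v0" for v0
  proof -
    \<comment> \<open>The majorant of the M-test blows up as v tends to minus infinity, so uniform
      convergence is claimed only to the right of v0 - 1.\<close>
    let ?S = "{v0 - 1<..}"
    have "uniform_limit ?S (\<lambda>N v. \<Sum>n<N. e i (- (real (Suc n) * exp v))) (\<lambda>v. \<Sum>n. e i (- (real (Suc n) * exp v))) sequentially"
    proof (rule Weierstrass_m_test)
      show "summable (\<lambda>n. C / exp (v0 - 1) ^ (0 + 2) * inverse (real (Suc n) ^ 2))"
        by (rule summable_mult[OF summable_inverse_Suc_squares])
      fix n v assume v: "v \<in> ?S"
      have "norm (e i (- (real (Suc n) * exp v))) \<le> C / exp v ^ (0 + 2) * inverse (real (Suc n) ^ 2)"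
        by (rule C(2)) simp
      also have "\<dots> \<le> C / exp (v0 - 1) ^ (0 + 2) * inverse (real (Suc n) ^ 2)"
        using v C(1) by (intro mult_right_mono divide_left_mono power_mono mult_pos_pos) auto
      finally show "norm (e i (- (real (Suc n) * exp v))) \<le> C / exp (v0 - 1) ^ (0 + 2) * inverse (real (Suc n) ^ 2)" .
    qed
    hence "continuous_on ?S (\<lambda>v. \<Sum>n. e i (- (real (Suc n) * exp v)))"
    proof (rule uniform_limit_theorem[rotated])
      have "continuous_on ?S (\<lambda>v. e i (- (real (Suc n) * exp v)))" for n
        by (rule continuous_on_compose2[OF continuous_on_schwartz_seq[OF e]]) (auto intro!: continuous_intros)
      thus "\<forall>\<^sub>F N in sequentially. continuous_on ?S (\<lambda>v. \<Sum>n<N. e i (- (real (Suc n) * exp v)))"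
        by (intro always_eventually allI continuous_on_sum)
    qed auto
    thus ?thesis
      unfolding lattice_sum_def by (rule continuous_on_interior) (simp add: interior_open)
  qed
  thus ?thesis by (simp add: continuous_on_eq_continuous_at)
qed

section \<open>Euler-Maclaurin expansion of lattice sums\<close>

text \<open>Used with y = 1 + n x: it bounds the sum over n of x / (1 + n x)^2 by a telescoping
  series, uniformly in x.\<close>

lemma divide_square_le_telescope:
  fixes x y :: real
  assumes "1 \<le> y" "0 < x" "x \<le> 1"
  shows "x / y ^ 2 \<le> 2 * (1 / y - 1 / (y + x))"
proof -
  have "x / (y * (2 * y)) \<le> x / (y * (y + x))"
    using assms by (intro divide_left_mono mult_left_mono mult_pos_pos) auto
  also have "\<dots> = 1 / y - 1 / (y + x)"
    using assms by (simp add: field_simps)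
  finally show ?thesis by (simp add: power2_eq_square)
qed

text \<open>Expand A(- n x) by Taylor's formula about - (n + 1) x and sum over n. The differences of
  A telescope to A(0). One step errs by at most a constant times x^(K+1) / (1 + n x)^2, and the sum
  of these is of order x^K. The constant 4 is the 2 of Taylor's formula times the 2 of the
  telescoping estimate.\<close>

lemma euler_maclaurin_step:
  assumes e: "schwartz_seq e"
    and A: "\<And>t. t \<le> 0 \<Longrightarrow> (A has_vector_derivative e 0 t) (at t within {..0})"
    and A0: "(A \<longlongrightarrow> 0) at_bot"
  shows "\<exists>C. \<forall>x. 0 < x \<and> x \<le> 1 \<longrightarrow>
     norm (A 0 - of_real x * (\<Sum>j<K. of_real (x ^ j / fact (Suc j)) * lattice_sum (e j) x)) \<le> C * x ^ K"
proof -
  obtain C where C: "C \<ge> 0" "\<And>t. t \<le> 0 \<Longrightarrow> norm (e K t) \<le> C / (1 - t) ^ 2"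
    using schwartz_seq_bound[OF e, of K 2] by blast
  have "norm (A 0 - of_real x * (\<Sum>j<K. of_real (x ^ j / fact (Suc j)) * lattice_sum (e j) x)) \<le> 4 * C * x ^ K"
    if x: "0 < x" "x \<le> 1" for x
  proof -
    define p where "p n = - (real n * x)" for n
    define T where "T n = A (p n) - A (p (Suc n)) - (\<Sum>j<K. e j (p (Suc n)) * of_real (x ^ Suc j / fact (Suc j)))" for n
    define u where "u n = 1 / (1 + real n * x)" for n
    have T_bound: "norm (T n) \<le> 4 * C * x ^ K * (u n - u (Suc n))" for n
    proof -
      \<comment> \<open>The sequence of derivatives with the antiderivative put in front, so that
        order K in \<open>e\<close> is order K + 1 here.\<close>
      define D where "D i = (case i of 0 \<Rightarrow> A | Suc j \<Rightarrow> e j)" for i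
      have D': "(D i has_vector_derivative D (Suc i) t) (at t within {p (Suc n)..p n})"
        if t: "t \<in> {p (Suc n)..p n}" for i t
      proof -
        have "p n \<le> 0" using x by (simp add: p_def)
        hence "t \<le> 0" "{p (Suc n)..p n} \<subseteq> {..0}" using t by auto
        moreover from this(1) have "(D i has_vector_derivative D (Suc i) t) (at t within {..0})"
          using A schwartz_seqD[OF e] by (cases i) (auto simp: D_def)
        ultimately show ?thesis by (rule_tac has_vector_derivative_within_subset)
      qed
      have B: "norm (D (Suc K) t) \<le> C / (1 + real n * x) ^ 2" if t: "t \<in> {p (Suc n)..p n}" for t
      proof -
        have t': "t \<le> - (real n * x)" "0 \<le> real n * x" using t x by (auto simp: p_def)
        hence "norm (e K t) \<le> C / (1 - t) ^ 2" by (intro C) linarith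
        also have "\<dots> \<le> C / (1 + real n * x) ^ 2"
          using t' C(1) by (intro divide_left_mono power_mono mult_pos_pos zero_less_power) linarith+
        finally show ?thesis by (simp add: D_def)
      qed
      have diff: "p n - p (Suc n) = x" by (simp add: p_def algebra_simps)
      have "norm (D 0 (p n) - (\<Sum>i\<le>K. D i (p (Suc n)) * of_real ((p n - p (Suc n)) ^ i / fact i)))
              \<le> 2 * (C / (1 + real n * x) ^ 2) * \<bar>p n - p (Suc n)\<bar> ^ Suc K"
        by (rule complex_valued_Taylor[of "{p (Suc n)..p n}"])
           (use D' B diff x in auto)
      also have "(\<Sum>i\<le>K. D i (p (Suc n)) * of_real ((p n - p (Suc n)) ^ i / fact i)) =
           A (p (Suc n)) + (\<Sum>j<K. e j (p (Suc n)) * of_real (x ^ Suc j / fact (Suc j)))"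
        unfolding sum.atMost_shift diff by (simp add: D_def)
      also have "D 0 (p n) - \<dots> = T n" by (simp add: D_def T_def)
      also have "2 * (C / (1 + real n * x) ^ 2) * \<bar>p n - p (Suc n)\<bar> ^ Suc K = 2 * C * x ^ K * (x / (1 + real n * x) ^ 2)"
        using x unfolding diff by simp
      also have "\<dots> \<le> 2 * C * x ^ K * (2 * (u n - u (Suc n)))"
      proof (intro mult_left_mono)
        have "u (Suc n) = 1 / (1 + real n * x + x)" by (simp add: u_def algebra_simps)
        moreover have "1 \<le> 1 + real n * x" using x by simp
        ultimately show "x / (1 + real n * x) ^ 2 \<le> 2 * (u n - u (Suc n))"
          using divide_square_le_telescope[of "1 + real n * x" x] x unfolding u_def by metis
      qed (use C x in auto)
      also have "\<dots> = 4 * C * x ^ K * (u n - u (Suc n))" by (simp add: algebra_simps)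
      finally show ?thesis .
    qed
    have T_sums: "T sums (A 0 - (\<Sum>j<K. lattice_sum (e j) x * of_real (x ^ Suc j / fact (Suc j))))"
    proof -
      have "filterlim (\<lambda>n. - (real n * x)) at_bot sequentially" using x(1) by real_asymp
      hence "(\<lambda>n. A (p n)) \<longlonglongrightarrow> 0" unfolding p_def by (rule filterlim_compose[OF A0])
      hence "(\<lambda>n. A (p n) - A (p (Suc n))) sums (A (p 0) - 0)" by (rule telescope_sums')
      moreover have "(\<lambda>n. \<Sum>j<K. e j (p (Suc n)) * of_real (x ^ Suc j / fact (Suc j))) sums
          (\<Sum>j<K. lattice_sum (e j) x * of_real (x ^ Suc j / fact (Suc j)))"
        unfolding p_def lattice_sum_def
        by (intro sums_sum sums_mult2 summable_sums summable_lattice[OF e x(1)])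
      ultimately have "(\<lambda>n. A (p n) - A (p (Suc n)) - (\<Sum>j<K. e j (p (Suc n)) * of_real (x ^ Suc j / fact (Suc j)))) sums
          (A (p 0) - 0 - (\<Sum>j<K. lattice_sum (e j) x * of_real (x ^ Suc j / fact (Suc j))))"
        by (rule sums_diff)
      thus ?thesis by (simp add: T_def [abs_def] p_def)
    qed
    have "u \<longlonglongrightarrow> 0" unfolding u_def using x(1) by real_asymp
    hence "(\<lambda>n. u n - u (Suc n)) sums (u 0 - 0)" by (rule telescope_sums')
    hence "(\<lambda>n. 4 * C * x ^ K * (u n - u (Suc n))) sums (4 * C * x ^ K * (u 0 - 0))" by (rule sums_mult)
    from norm_sums_le[OF T_sums this T_bound]
    have "norm (A 0 - (\<Sum>j<K. lattice_sum (e j) x * of_real (x ^ Suc j / fact (Suc j)))) \<le> 4 * C * x ^ K"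
      by (simp add: u_def)
    also have "(\<Sum>j<K. lattice_sum (e j) x * of_real (x ^ Suc j / fact (Suc j))) =
       of_real x * (\<Sum>j<K. of_real (x ^ j / fact (Suc j)) * lattice_sum (e j) x)"
      unfolding sum_distrib_left by (intro sum.cong refl) (simp add: mult_ac)
    finally show ?thesis .
  qed
  thus ?thesis by blast
qed

text \<open>The power series of \<open>(exp X - 1) / X\<close>; the coefficients of its inverse are \<open>B\<^sub>n / n!\<close> with the
  Bernoulli numbers \<open>B\<^sub>n\<close>.\<close>

definition exp_quotient_fps :: "complex fps" where
  "exp_quotient_fps = Abs_fps (\<lambda>n. 1 / fact (Suc n))"

text \<open>Shifted by one because the constant coefficient 1 of the inverse series belongs to the 1
  / x term; thus \<open>em_coeff k\<close> is B_(k+1) / (k+1)!.\<close>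

definition em_coeff :: "nat \<Rightarrow> complex" where
  "em_coeff k = fps_nth (inverse exp_quotient_fps) (Suc k)"

lemma inverse_exp_quotient_fps: "inverse exp_quotient_fps * exp_quotient_fps = 1"
  by (rule inverse_mult_eq_1) (simp add: exp_quotient_fps_def)

text \<open>The series B(X) = X / (exp X - 1) satisfies B(-X) = B(X) + X, so its odd coefficients
  beyond the first vanish. These are the trivial zeros of zeta.\<close>

lemma em_coeff_even_eq_0:
  assumes "even k" "k > 0"
  shows "em_coeff k = 0"
proof -
  define D where "D = exp_quotient_fps"
  define B where "B = inverse D"
  define X' :: "complex fps" where "X' = fps_const (-1) * fps_X"
  have BD: "B * D = 1" unfolding B_def D_def by (rule inverse_exp_quotient_fps)
  have X'0: "X' $ 0 = 0" by (simp add: X'_def)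
  have XD: "fps_X * D = fps_exp 1 - 1"
    by (rule fps_ext) (auto simp: D_def exp_quotient_fps_def fps_X_mult_nth gr0_conv_Suc)
  have "(fps_X * D) oo X' = (fps_exp 1 - 1) oo X'" by (simp add: XD)
  hence "X' * (D oo X') = fps_exp (-1) - 1"
    using X'0 by (simp add: fps_compose_mult_distrib fps_compose_sub_distrib fps_X_fps_compose_startby0 X'_def)
  hence "fps_exp 1 * (X' * (D oo X')) = fps_exp 1 * (fps_exp (-1) - 1)" by simp
  also have "\<dots> = 1 - fps_exp 1"
    by (simp add: right_diff_distrib flip: fps_exp_add_mult)
  also have "\<dots> = - (fps_X * D)" by (simp add: XD)
  finally have "fps_X * (fps_exp 1 * (D oo X')) = fps_X * D"
    by (simp add: X'_def mult_ac flip: fps_const_neg)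
  hence eq: "fps_exp 1 * (D oo X') = D" by simp
  have "(B oo X') * (D oo X') = (B * D) oo X'"
    using X'0 by (simp add: fps_compose_mult_distrib)
  hence BD': "(B oo X') * (D oo X') = 1" by (simp add: BD)
  \<comment> \<open>Insert 1 = B(X) D(X) with D(X) rewritten by \<open>eq\<close>, then cancel D(-X)
    against B(-X).\<close>
  have "B oo X' = (B oo X') * (B * (fps_exp 1 * (D oo X')))" by (simp add: eq BD)
  also have "\<dots> = ((B oo X') * (D oo X')) * (B * fps_exp 1)" by (simp add: mult_ac)
  also have "\<dots> = B * (1 + fps_X * D)" by (simp add: BD' XD)
  also have "\<dots> = B + fps_X" using BD by (simp add: algebra_simps)
  finally have "(B oo X') $ Suc k = (B + fps_X) $ Suc k" by simp
  moreover have "(B oo X') $ Suc k = (-1) ^ Suc k * B $ Suc k"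
    unfolding X'_def fps_compose_linear by simp
  ultimately show ?thesis using assms
    by (simp add: em_coeff_def B_def D_def fps_X_def)
qed

text \<open>Taylor expansion expresses \<open>A 0 / x\<close>, for an antiderivative \<open>A\<close>, through the lattice sums of the
  derivatives with the coefficients of \<open>(exp X - 1) / X\<close>; the inverse series undoes this.\<close>

theorem euler_maclaurin:
  assumes e: "schwartz_seq e"
  defines "I \<equiv> LINT v|lborel. exp (of_real v) * e 0 (- exp v)"
  shows "\<exists>C. \<forall>x. 0 < x \<and> x \<le> 1 \<longrightarrow>
    norm (lattice_sum (e 0) x - I / of_real x - (\<Sum>k<K. em_coeff k * e k 0 * of_real x ^ k)) \<le> C * x ^ K"
proof -
  \<comment> \<open>The values at 0 of the antiderivative and of the successive derivatives.\<close>
  define \<alpha> where "\<alpha> i = (case i of 0 \<Rightarrow> I | Suc j \<Rightarrow> e j 0)" for i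
  define B where "B = fps_nth (inverse exp_quotient_fps)"
  \<comment> \<open>The order of truncation falls with \<open>i\<close>, so that after weighting
    with x^i every error is of order x^(K+1).\<close>
  define G where "G i x = of_real x * (\<Sum>j<Suc K - i. of_real (x ^ j / fact (Suc j)) * lattice_sum (e (j + i)) x)" for i x
  have "\<exists>C. \<forall>x. 0 < x \<and> x \<le> 1 \<longrightarrow> norm (\<alpha> i - G i x) \<le> C * x ^ (Suc K - i)" for i
  proof (cases i)
    case 0
    obtain A where A: "\<And>t. t \<le> 0 \<Longrightarrow> (A has_vector_derivative e 0 t) (at t within {..0})"
      "A 0 = I" "(A \<longlongrightarrow> 0) at_bot"
      using schwartz_seq_antiderivative[OF e] unfolding I_def by metis
    from euler_maclaurin_step[OF e A(1,3), of "Suc K"] show ?thesis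
      by (simp add: G_def \<alpha>_def 0 A(2))
  next
    case (Suc j)
    have "\<exists>C. \<forall>x. 0 < x \<and> x \<le> 1 \<longrightarrow> norm (e j 0 - of_real x * (\<Sum>l<Suc K - i. of_real (x ^ l / fact (Suc l)) * lattice_sum (e (l + Suc j)) x))
        \<le> C * x ^ (Suc K - i)"
      by (rule euler_maclaurin_step[OF schwartz_seq_shift[OF e]])
         (use schwartz_seqD[OF e, of _ j] schwartz_seq_tendsto_at_bot[OF e] in auto)
    thus ?thesis by (simp add: G_def \<alpha>_def Suc)
  qed
  then obtain C where C: "\<And>i x. 0 < x \<Longrightarrow> x \<le> 1 \<Longrightarrow> norm (\<alpha> i - G i x) \<le> C i * x ^ (Suc K - i)"
    by metis
  define M where "M = (\<Sum>i\<le>K. norm (B i) * C i)"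
  have "norm (lattice_sum (e 0) x - I / of_real x - (\<Sum>k<K. em_coeff k * e k 0 * of_real x ^ k)) \<le> M * x ^ K"
    if x: "0 < x" "x \<le> 1" for x
  proof -
    have "(\<Sum>i\<le>K. B i * of_real x ^ i * G i x) =
       of_real x * (\<Sum>i\<le>K. \<Sum>j\<le>K - i. B i * of_real x ^ (i + j) / fact (Suc j) * lattice_sum (e (i + j)) x)"
      unfolding sum_distrib_left
    proof (intro sum.cong refl)
      fix i assume "i \<in> {..K}"
      hence *: "{..<Suc K - i} = {..K - i}" by auto
      show "B i * of_real x ^ i * G i x =
          (\<Sum>j\<le>K - i. of_real x * (B i * of_real x ^ (i + j) / fact (Suc j) * lattice_sum (e (i + j)) x))"
        unfolding G_def * sum_distrib_left
        by (intro sum.cong refl) (simp add: power_add add.commute)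
    qed
    also have "(\<Sum>i\<le>K. \<Sum>j\<le>K - i. B i * of_real x ^ (i + j) / fact (Suc j) * lattice_sum (e (i + j)) x) =
       (\<Sum>(i,j)\<in>{(i,j). i + j \<le> K}. B i * of_real x ^ (i + j) / fact (Suc j) * lattice_sum (e (i + j)) x)"
      by (subst sum.Sigma) (auto intro!: sum.cong)
    \<comment> \<open>Collecting the terms with i + j = n turns the coefficient of the n-th lattice
      sum into a coefficient of the product of \<open>exp_quotient_fps\<close> with its inverse;
      only n = 0 survives.\<close>
    also have "\<dots> = (\<Sum>n\<le>K. \<Sum>i\<le>n. B i * of_real x ^ (i + (n - i)) / fact (Suc (n - i)) * lattice_sum (e (i + (n - i))) x)"
      by (rule sum.triangle_reindex_eq)
    also have "\<dots> = (\<Sum>n\<le>K. of_real x ^ n * lattice_sum (e n) x * (if n = 0 then 1 else 0))"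
    proof (intro sum.cong refl)
      fix n assume "n \<in> {..K}"
      have "(\<Sum>i\<le>n. B i * of_real x ^ (i + (n - i)) / fact (Suc (n - i)) * lattice_sum (e (i + (n - i))) x)
          = of_real x ^ n * lattice_sum (e n) x * (\<Sum>i=0..n. B i * fps_nth exp_quotient_fps (n - i))"
        unfolding sum_distrib_left by (rule sum.cong) (auto simp: exp_quotient_fps_def)
      also have "(\<Sum>i=0..n. B i * fps_nth exp_quotient_fps (n - i)) = (if n = 0 then 1 else 0)"
        unfolding B_def fps_mult_nth[symmetric] inverse_exp_quotient_fps by simp
      finally show "(\<Sum>i\<le>n. B i * of_real x ^ (i + (n - i)) / fact (Suc (n - i)) * lattice_sum (e (i + (n - i))) x) =
         of_real x ^ n * lattice_sum (e n) x * (if n = 0 then 1 else 0)" .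
    qed
    also have "\<dots> = lattice_sum (e 0) x"
      by (simp add: if_distrib[of "(*) _"] sum.delta cong: if_cong)
    finally have G: "(\<Sum>i\<le>K. B i * of_real x ^ i * G i x) = of_real x * lattice_sum (e 0) x" .
    have B0: "B 0 = 1" by (simp add: B_def exp_quotient_fps_def)
    have em_B: "em_coeff k = B (Suc k)" for k by (simp add: B_def em_coeff_def)
    have "norm (\<Sum>i\<le>K. B i * of_real x ^ i * (\<alpha> i - G i x)) \<le> (\<Sum>i\<le>K. norm (B i) * C i * x ^ Suc K)"
    proof (rule sum_norm_le)
      fix i assume i: "i \<in> {..K}"
      have "norm (B i * of_real x ^ i * (\<alpha> i - G i x)) = norm (B i) * x ^ i * norm (\<alpha> i - G i x)"
        using x by (simp add: norm_mult norm_power)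
      also have "\<dots> \<le> norm (B i) * x ^ i * (C i * x ^ (Suc K - i))"
        using x by (intro mult_left_mono C) auto
      also have "\<dots> = norm (B i) * C i * (x ^ i * x ^ (Suc K - i))" by simp
      also have "x ^ i * x ^ (Suc K - i) = x ^ Suc K"
        using i by (subst power_add[symmetric]) simp
      finally show "norm (B i * of_real x ^ i * (\<alpha> i - G i x)) \<le> norm (B i) * C i * x ^ Suc K" .
    qed
    also have "(\<Sum>i\<le>K. B i * of_real x ^ i * (\<alpha> i - G i x)) =
        (\<Sum>i\<le>K. B i * of_real x ^ i * \<alpha> i) - of_real x * lattice_sum (e 0) x"
      unfolding G[symmetric] by (simp add: right_diff_distrib sum_subtractf)
    also have "(\<Sum>i\<le>K. B i * of_real x ^ i * \<alpha> i) = I + of_real x * (\<Sum>k<K. em_coeff k * e k 0 * of_real x ^ k)"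
      unfolding sum.atMost_shift sum_distrib_left
      by (simp add: B0 \<alpha>_def em_B mult_ac)
    also have "(\<Sum>i\<le>K. norm (B i) * C i * x ^ Suc K) = M * x ^ K * x"
      unfolding M_def sum_distrib_right by (intro sum.cong refl) simp
    also have "I + of_real x * (\<Sum>k<K. em_coeff k * e k 0 * of_real x ^ k) - of_real x * lattice_sum (e 0) x
       = - of_real x * (lattice_sum (e 0) x - I / of_real x - (\<Sum>k<K. em_coeff k * e k 0 * of_real x ^ k))"
      using x by (simp add: algebra_simps)
    finally have "norm (lattice_sum (e 0) x - I / of_real x - (\<Sum>k<K. em_coeff k * e k 0 * of_real x ^ k)) * x \<le> M * x ^ K * x"
      using x by (simp add: norm_mult mult.commute)
    thus ?thesis using x(1) by (rule mult_right_le_imp_le)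
  qed
  thus ?thesis by blast
qed

section \<open>The zeta function\<close>

lemma laplace_expansion_lattice_sum:
  assumes e: "schwartz_seq e"
  shows "laplace_expansion (\<lambda>v. lattice_sum (e 0) (exp v))
           (LINT v|lborel. exp (of_real v) * e 0 (- exp v)) (\<lambda>k. em_coeff k * e k 0)"
    (is "laplace_expansion _ ?I _")
proof
  show "continuous_on UNIV (\<lambda>v. lattice_sum (e 0) (exp v))"
    by (rule continuous_on_lattice_sum_exp[OF e])
next
  fix K
  obtain C where C: "\<And>x. 0 < x \<Longrightarrow> x \<le> 1 \<Longrightarrow> 
      norm (lattice_sum (e 0) x - ?I / of_real x - (\<Sum>k<K. em_coeff k * e k 0 * of_real x ^ k)) \<le> C * x ^ K"
    using euler_maclaurin[OF e, of K] by blast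
  have "norm (lattice_sum (e 0) (exp v) - ?I * of_real (exp (- v)) - (\<Sum>k<K. em_coeff k * e k 0 * of_real (exp (real k * v))))
              \<le> C * exp (real K * v)" if "v \<le> 0" for v
    using C[of "exp v"] that by (simp add: exp_of_nat_mult exp_minus divide_inverse)
  thus "\<exists>C. \<forall>v\<le>0. norm (lattice_sum (e 0) (exp v) - ?I * of_real (exp (- v)) - (\<Sum>k<K. em_coeff k * e k 0 * of_real (exp (real k * v))))
              \<le> C * exp (real K * v)" by blast
next
  fix m
  obtain C where C: "\<And>x. 1 \<le> x \<Longrightarrow> norm (lattice_sum (e 0) x) \<le> C / x ^ m"
    using lattice_sum_decay[OF e, of 0 m] by blast
  have "norm (lattice_sum (e 0) (exp v)) \<le> C * exp (- (real m * v))" if "v \<ge> 0" for v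
    using C[of "exp v"] that by (simp add: exp_of_nat_mult exp_minus divide_inverse)
  thus "\<exists>C. \<forall>v\<ge>0. norm (lattice_sum (e 0) (exp v)) \<le> C * exp (- (real m * v))" by blast
qed

lemma powr_minus_Suc_eq_exp:
  "of_nat (Suc n) powr (- z) = exp (- (z * complex_of_real (ln (real (Suc n)))))"
proof -
  have "(of_nat (Suc n) :: complex) \<noteq> 0" by (simp del: of_nat_Suc)
  moreover have "Ln (of_nat (Suc n)) = of_real (ln (real (Suc n)))"
    using Ln_of_nat[of "Suc n"] by simp
  ultimately show ?thesis by (simp add: powr_def del: of_nat_Suc)
qed

lemma norm_powr_minus_Suc: "norm (of_nat (Suc n) powr (- z) :: complex) = real (Suc n) powr (- Re z)"
  unfolding powr_minus_Suc_eq_exp by (simp add: powr_def del: of_nat_Suc)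

lemma summable_norm_powr_minus_Suc:
  assumes "Re z > 1"
  shows "summable (\<lambda>n. norm (of_nat (Suc n) powr (- z) :: complex))"
proof -
  have "summable (\<lambda>n. real n powr (- Re z))" using assms by (subst summable_real_powr_iff) simp
  thus ?thesis unfolding norm_powr_minus_Suc by (subst (asm) summable_Suc_iff[symmetric])
qed

text \<open>Translating v by ln n multiplies the transform by n^(-z), and Re z > 1 gives absolute
  convergence for exchanging sum and integral. The Dirichlet series has an arbitrary name
  \<open>Z\<close> because the lemma serves first to construct the zeta function and later to use
  it.\<close>

lemma lattice_sum_transform:
  assumes e: "schwartz_seq e" and z: "Re z > 1"
    and Z: "(\<lambda>n. of_nat (Suc n) powr (- z)) sums Z"
  shows "(LINT v|lborel. exp (z * of_real v) * lattice_sum (e 0) (exp v)) =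
     Z * (LINT v|lborel. exp (z * of_real v) * e 0 (- exp v))"
proof -
  interpret P: laplace_expansion "\<lambda>v. e 0 (- exp v)" 0 "\<lambda>k. (-1) ^ k / fact k * e k 0"
    by (rule laplace_expansion_schwartz[OF e])
  define g where "g v = exp (z * of_real v) * e 0 (- exp v)" for v
  define f where "f n v = exp (z * of_real v) * e 0 (- (real (Suc n) * exp v))" for n v
  have g: "integrable lborel g"
    unfolding g_def using P.integrable_transform[of z] z by simp
  have f_eq: "f n v = of_nat (Suc n) powr (- z) * g (ln (real (Suc n)) + 1 * v)" for n v
  proof -
    have "exp (z * of_real v) = exp (- (z * of_real (ln (real (Suc n))))) * exp (z * of_real (ln (real (Suc n)) + 1 * v))"
      unfolding exp_add[symmetric] by (simp add: algebra_simps)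
    moreover have "exp (ln (real (Suc n)) + 1 * v) = real (Suc n) * exp v"
      unfolding exp_add by simp
    ultimately show ?thesis unfolding f_def g_def powr_minus_Suc_eq_exp by simp
  qed
  have f: "integrable lborel (f n)" for n
    unfolding f_eq [abs_def] by (intro integrable_mult_right lborel_integrable_real_affine g) auto
  have f_int: "integral\<^sup>L lborel (f n) = of_nat (Suc n) powr (- z) * integral\<^sup>L lborel g" for n
    unfolding f_eq [abs_def] integral_mult_right_zero
    by (subst (2) lborel_integral_real_affine[of 1 _ "ln (real (Suc n))"]) simp_all
  have nf_int: "(LINT v|lborel. norm (f n v)) = norm (of_nat (Suc n) powr (- z) :: complex) * (LINT v|lborel. norm (g v))" for n
    unfolding f_eq [abs_def] norm_mult integral_mult_right_zero
    by (subst (2) lborel_integral_real_affine[of 1 _ "ln (real (Suc n))"]) simp_all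
  have sm: "summable (\<lambda>n. norm (f n v))" for v
  proof -
    obtain C where C: "\<And>n. norm (e 0 (- (real (Suc n) * exp v))) \<le> C / exp v ^ (0 + 2) * inverse (real (Suc n) ^ 2)"
      using schwartz_seq_lattice_bound[OF e, of 0 0] exp_gt_zero by blast
    have "summable (\<lambda>n. norm (exp (z * of_real v)) * (C / exp v ^ (0 + 2) * inverse (real (Suc n) ^ 2)))"
      by (intro summable_mult summable_inverse_Suc_squares)
    thus ?thesis
    proof (rule summable_comparison_test')
      show "norm (norm (f n v)) \<le> norm (exp (z * of_real v)) * (C / exp v ^ (0 + 2) * inverse (real (Suc n) ^ 2))" for n
        unfolding f_def norm_mult real_norm_def abs_mult abs_norm_cancel
        by (intro mult_left_mono C) auto
    qed
  qed
  have "(\<lambda>n. integral\<^sup>L lborel (f n)) sums (LINT v|lborel. (\<Sum>n. f n v))"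
  proof (rule sums_integral)
    show "AE v in lborel. summable (\<lambda>n. norm (f n v))" using sm by simp
    show "summable (\<lambda>n. LINT v|lborel. norm (f n v))"
      unfolding nf_int by (intro summable_mult2 summable_norm_powr_minus_Suc z)
  qed (rule f)
  moreover have "(\<Sum>n. f n v) = exp (z * of_real v) * lattice_sum (e 0) (exp v)" for v
    unfolding f_def lattice_sum_def by (intro suminf_mult summable_lattice e) auto
  moreover have "(\<lambda>n. integral\<^sup>L lborel (f n)) sums (Z * integral\<^sup>L lborel g)"
    unfolding f_int by (intro sums_mult2 Z)
  ultimately show ?thesis unfolding g_def [symmetric] by (simp add: sums_unique2)
qed

lemma Gamma_eq_transform:
  assumes z: "Re z > 0"
  shows "(LINT v|lborel. exp (z * of_real v) * of_real (exp (- exp v))) = Gamma z"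
proof -
  interpret P: laplace_expansion "\<lambda>v. of_real (exp (- exp v))" 0 "\<lambda>k. (-1) ^ k / fact k * of_real (exp 0)"
    using laplace_expansion_schwartz[OF schwartz_seq_exp] .
  let ?f = "\<lambda>u. of_real u powr (z - 1) * of_real (exp (- u)) :: complex"
  have f: "?f = (\<lambda>u. of_real u powr (z - 1) / of_real (exp u))"
    by (simp add: exp_minus divide_inverse)
  have cont: "continuous_on {0<..} (\<lambda>u::real. of_real (exp (- u)) :: complex)"
    by (intro continuous_intros)
  hence "set_borel_measurable borel {0<..} (\<lambda>u::real. of_real (exp (- u)) :: complex)"
    by (intro set_measurable_continuous_on) auto
  hence "(LINT v|lborel. exp (z * of_real v) * of_real (exp (- exp v))) = (LINT u:{0<..}|lborel. ?f u)"
    by (intro integral_powr_exp_substitution[symmetric] P.integrable_transform) (use z in auto)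
  also have "\<dots> = integral {0<..} ?f"
  proof (rule set_borel_integral_eq_integral(2))
    have "set_integrable lebesgue {0<..} ?f"
      using absolutely_integrable_Gamma_integral'[OF z] by (simp add: f)
    moreover have "continuous_on {0<..} ?f"
      by (intro continuous_intros) auto
    hence "(\<lambda>u. indicator {0<..} u *\<^sub>R ?f u) \<in> borel_measurable lborel"
      using set_measurable_continuous_on[of "{0<..}" ?f] by (simp add: set_borel_measurable_def)
    ultimately show "set_integrable lborel {0<..} ?f"
      unfolding set_integrable_def using integrable_completion by blast
  qed
  also have "\<dots> = Gamma z"
    using Gamma_integral_complex'[OF z] unfolding f by (rule integral_unique)
  finally show ?thesis .
qed

lemma open_Re_greater: "open {z. Re z > c}"
  by (intro open_Collect_less continuous_intros)

lemma connected_punctured_complex_plane: "connected (- {1::complex})"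
  using connected_open_diff_countable[of "UNIV :: complex set" "{1}"] convex_connected[OF convex_UNIV]
  by (simp add: Compl_eq_Diff_UNIV)

text \<open>The definite description needs existence and uniqueness. The witness is the continuation
  belonging to exp, whose own transform Gamma cancels \<open>rGamma\<close>; uniqueness is the
  identity theorem on the connected set - {1}.\<close>

lemma
  shows holomorphic_riemann_zeta: "riemann_zeta holomorphic_on - {1}"
    and riemann_zeta_sums: "\<And>s. Re s > 1 \<Longrightarrow> (\<lambda>n. of_nat (Suc n) powr (- s)) sums riemann_zeta s"
    and riemann_zeta_minus_of_nat: "\<And>k. riemann_zeta (- of_nat k) = (-1) ^ k * fact k * em_coeff k"
proof -
  \<comment> \<open>All derivatives of exp equal 1 at 0, so the expansion coefficients are exactly
    \<open>em_coeff k\<close>.\<close>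
  let ?e = "\<lambda>(n::nat) t. of_real (exp t) :: complex"
  interpret S: laplace_expansion "\<lambda>v. lattice_sum (?e 0) (exp v)"
      "LINT v|lborel. exp (of_real v) * ?e 0 (- exp v)" "\<lambda>k. em_coeff k * ?e k 0"
    by (rule laplace_expansion_lattice_sum[OF schwartz_seq_exp])
  define f where "f s = (if s = 1 then 0 else S.continuation s)" for s
  have holo: "f holomorphic_on - {1}"
    by (rule holomorphic_transform[OF S.holomorphic_continuation[of "- {1}"]]) (auto simp: f_def)
  have sums: "(\<lambda>n. of_nat (Suc n) powr (- s)) sums f s" if s: "Re s > 1" for s
  proof -
    have "summable (\<lambda>n. of_nat (Suc n) powr (- s) :: complex)"
      by (rule summable_norm_cancel[OF summable_norm_powr_minus_Suc[OF s]])
    then obtain Z where Z: "(\<lambda>n. of_nat (Suc n) powr (- s)) sums Z" by (auto simp: summable_def)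
    have "f s = rGamma s * (Z * Gamma s)"
      using S.continuation_eq_integral[of s] lattice_sum_transform[OF schwartz_seq_exp s Z] s
        Gamma_eq_transform[of s] by (auto simp: f_def)
    moreover have "s \<notin> \<int>\<^sub>\<le>\<^sub>0" using s by (auto elim!: nonpos_Ints_cases)
    hence "Gamma s \<noteq> 0" by (simp add: Gamma_eq_zero_iff)
    ultimately have "f s = Z" by (simp add: rGamma_inverse_Gamma)
    with Z show ?thesis by simp
  qed
  have zeta: "riemann_zeta = f"
    unfolding riemann_zeta_def
  proof (rule the_equality)
    show "f holomorphic_on - {1} \<and> f 1 = 0 \<and> (\<forall>s. Re s > 1 \<longrightarrow> (\<lambda>n. of_nat (Suc n) powr (- s)) sums f s)"
      using holo sums by (auto simp: f_def)
  next
    fix h :: "complex \<Rightarrow> complex"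
    assume h: "h holomorphic_on - {1} \<and> h 1 = 0 \<and> (\<forall>s. Re s > 1 \<longrightarrow> (\<lambda>n. of_nat (Suc n) powr (- s)) sums h s)"
    show "h = f"
    proof
      fix s
      show "h s = f s"
      proof (cases "s = 1")
        case False
        show ?thesis
        proof (rule analytic_continuation_open[of "{z. Re z > 1}" "- {1}" h f])
          show "{z. Re z > 1} \<noteq> {}" by (auto intro!: exI[of _ 2])
          show "h z = f z" if "z \<in> {z. Re z > 1}" for z
            using h sums that by (auto intro: sums_unique2)
        qed (use h holo False open_Re_greater connected_punctured_complex_plane in auto)
      qed (use h in \<open>auto simp: f_def\<close>)
    qed
  qed
  show "riemann_zeta holomorphic_on - {1}" unfolding zeta by (rule holo)
  show "(\<lambda>n. of_nat (Suc n) powr (- s)) sums riemann_zeta s" if "Re s > 1" for s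
    unfolding zeta by (rule sums[OF that])
  show "riemann_zeta (- of_nat k) = (-1) ^ k * fact k * em_coeff k" for k
  proof -
    have "Re (- of_nat k :: complex) \<noteq> Re 1" by simp
    hence "- of_nat k \<noteq> (1::complex)" by metis
    thus ?thesis
      using S.continuation_minus_of_nat[of k] by (simp add: zeta f_def)
  qed
qed

section \<open>The transform of a lattice sum\<close>

text \<open>With z = - s, the \<open>rGamma\<close> in the continuation is the factor 1 / Gamma(- s)
  of the definition. The identity theorem, starting from Re s < 0, makes the description
  unique.\<close>

lemma complex_order_deriv0_eq:
  assumes F: "schwartz_left F"
  shows "complex_order_deriv0 F =
    (\<lambda>s. laplace_expansion.continuation (\<lambda>v. F (- exp v)) 0 (\<lambda>k. (-1) ^ k / fact k * left_deriv k F 0) (- s))"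
proof -
  have e: "schwartz_seq (\<lambda>n. left_deriv n F)" by (rule schwartz_seq_left_deriv[OF F])
  interpret P: laplace_expansion "\<lambda>v. F (- exp v)" 0 "\<lambda>k. (-1) ^ k / fact k * left_deriv k F 0"
    using laplace_expansion_schwartz[OF e] by simp
  let ?H = "\<lambda>s. P.continuation (- s)"
  have holo: "?H holomorphic_on UNIV"
    using holomorphic_on_compose[of uminus UNIV P.continuation] P.holomorphic_continuation[of "range uminus"]
    by (simp add: comp_def holomorphic_on_minus)
  have "continuous_on {..0} F"
    using continuous_on_schwartz_seq[OF e, of 0] by simp
  hence "continuous_on {0<..} (\<lambda>u. F (- u))"
    by (rule continuous_on_compose2) (auto intro!: continuous_intros)
  hence meas: "set_borel_measurable borel {0<..} (\<lambda>u. F (- u))"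
    by (intro set_measurable_continuous_on) auto
  have eq: "?H s = 1 / Gamma (- s) * (LINT u:{0<..}|lborel. of_real u powr (- s - 1) * F (- u))"
    if s: "Re s < 0" for s
  proof -
    have "Re (- s) > 0" using s by simp
    from P.integrable_transform[OF this] P.continuation_eq_integral[OF this] show ?thesis
      by (simp add: integral_powr_exp_substitution[OF meas] rGamma_inverse_Gamma divide_inverse)
  qed
  show ?thesis
    unfolding complex_order_deriv0_def
  proof (rule the_equality)
    show "?H holomorphic_on UNIV \<and> (\<forall>s. Re s < 0 \<longrightarrow>
        ?H s = 1 / Gamma (- s) * (LINT u:{0<..}|lborel. of_real u powr (- s - 1) * F (- u)))"
      using holo eq by blast
  next
    fix G
    assume G: "G holomorphic_on UNIV \<and> (\<forall>s. Re s < 0 \<longrightarrow>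
        G s = 1 / Gamma (- s) * (LINT u:{0<..}|lborel. of_real u powr (- s - 1) * F (- u)))"
    show "G = ?H"
    proof
      fix s
      show "G s = ?H s"
      proof (rule analytic_continuation_open[of "{z. Re z < 0}" UNIV G ?H])
        show "open {z. Re z < 0}" by (intro open_Collect_less continuous_intros)
        show "{z. Re z < 0} \<noteq> {}" by (auto intro!: exI[of _ "-1"])
        show "connected (UNIV :: complex set)" by (rule convex_connected[OF convex_UNIV])
        show "G z = ?H z" if "z \<in> {z. Re z < 0}" for z using G eq that by simp
      qed (use G holo in auto)
    qed
  qed
qed

text \<open>The identity theorem on - {1} carries \<open>lattice_sum_transform\<close> over from Re
  z > 1.\<close>

lemma lattice_continuation_eq:
  assumes e: "schwartz_seq e" and z: "z \<noteq> 1"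
  shows "laplace_expansion.continuation (\<lambda>v. lattice_sum (e 0) (exp v))
           (LINT v|lborel. exp (of_real v) * e 0 (- exp v)) (\<lambda>k. em_coeff k * e k 0) z =
         riemann_zeta z *
         laplace_expansion.continuation (\<lambda>v. e 0 (- exp v)) 0 (\<lambda>k. (-1) ^ k / fact k * e k 0) z"
proof -
  interpret S: laplace_expansion "\<lambda>v. lattice_sum (e 0) (exp v)"
    "LINT v|lborel. exp (of_real v) * e 0 (- exp v)" "\<lambda>k. em_coeff k * e k 0"
    by (rule laplace_expansion_lattice_sum[OF e])
  interpret P: laplace_expansion "\<lambda>v. e 0 (- exp v)" 0 "\<lambda>k. (-1) ^ k / fact k * e k 0"
    by (rule laplace_expansion_schwartz[OF e])
  show ?thesis
  proof (rule analytic_continuation_open[of "{z. Re z > 1}" "- {1}" S.continuation "\<lambda>z. riemann_zeta z * P.continuation z"])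
    show "{z. Re z > 1} \<noteq> {}" by (auto intro!: exI[of _ 2])
    show "S.continuation holomorphic_on - {1}" by (rule S.holomorphic_continuation) auto
    show "(\<lambda>z. riemann_zeta z * P.continuation z) holomorphic_on - {1}"
      by (intro holomorphic_on_mult holomorphic_riemann_zeta P.holomorphic_continuation) auto
    show "S.continuation z = riemann_zeta z * P.continuation z" if "z \<in> {z. Re z > 1}" for z
      using that S.continuation_eq_integral[of z] P.continuation_eq_integral[of z]
        lattice_sum_transform[OF e _ riemann_zeta_sums, of z] by simp
  qed (use z open_Re_greater connected_punctured_complex_plane in auto)
qed

text \<open>With t = - exp v, the v-derivative of \<open>e 0 (- exp v)\<close> is t times the
  derivative of \<open>e 0\<close> at t. Integration by parts proves the claim for Re z > 0, and the
  identity theorem extends it.\<close>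

lemma continuation_euler_derivative:
  fixes e :: "nat \<Rightarrow> real \<Rightarrow> complex"
  assumes e: "schwartz_seq e"
  defines "e' \<equiv> \<lambda>n t. of_real t * e (Suc n) t + of_nat n * e n t"
  shows "laplace_expansion.continuation (\<lambda>v. e' 0 (- exp v)) 0 (\<lambda>k. (-1) ^ k / fact k * e' k 0) z =
     - z * laplace_expansion.continuation (\<lambda>v. e 0 (- exp v)) 0 (\<lambda>k. (-1) ^ k / fact k * e k 0) z"
proof -
  have e': "schwartz_seq e'" unfolding e'_def by (rule schwartz_seq_euler[OF e])
  interpret P: laplace_expansion "\<lambda>v. e 0 (- exp v)" 0 "\<lambda>k. (-1) ^ k / fact k * e k 0"
    by (rule laplace_expansion_schwartz[OF e])
  interpret P': laplace_expansion "\<lambda>v. e' 0 (- exp v)" 0 "\<lambda>k. (-1) ^ k / fact k * e' k 0"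
    by (rule laplace_expansion_schwartz[OF e'])
  have parts: "(LINT v|lborel. exp (z * of_real v) * e' 0 (- exp v)) =
       - z * (LINT v|lborel. exp (z * of_real v) * e 0 (- exp v))" if z: "Re z > 0" for z
  proof -
    let ?F = "\<lambda>v. exp (z * of_real v) * e 0 (- exp v)"
    let ?f = "\<lambda>v. exp (z * of_real v) * e' 0 (- exp v) + z * (exp (z * of_real v) * e 0 (- exp v))"
    have int: "integrable lborel (\<lambda>v. exp (z * of_real v) * e' 0 (- exp v))" "integrable lborel ?F"
      using P'.integrable_transform[of z] P.integrable_transform[of z] z by auto
    \<comment> \<open>Used with m = 0 for the boundary term at minus infinity, where Re z > 0 helps,
      and with m > Re z for the one at plus infinity.\<close>
    have bound: "\<exists>C. \<forall>v. norm (?F v) \<le> C * exp ((Re z - real m) * v)" for m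
    proof -
      obtain C where C: "C \<ge> 0" "\<And>t. t \<le> 0 \<Longrightarrow> norm (e 0 t) \<le> C / (1 - t) ^ m"
        using schwartz_seq_bound[OF e, of 0 m] by blast
      have "norm (?F v) \<le> C * exp ((Re z - real m) * v)" for v
      proof -
        have "norm (?F v) \<le> exp (Re z * v) * (C / (1 - (- exp v)) ^ m)"
          by (simp only: norm_mult norm_exp_eq_Re) (intro mult_mono C; simp)
        also have "\<dots> \<le> exp (Re z * v) * (C / exp v ^ m)"
          using C(1) by (intro mult_left_mono divide_left_mono power_mono mult_pos_pos zero_less_power)
            (auto intro!: add_pos_pos)
        also have "\<dots> = C * exp ((Re z - real m) * v)"
          by (simp add: left_diff_distrib exp_diff exp_of_nat_mult)
        finally show ?thesis .
      qed
      thus ?thesis by blast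
    qed
    have "(LBINT v=-\<infinity>..\<infinity>. ?f v) = 0 - 0"
    proof (rule interval_integral_FTC_integrable[where F = ?F])
      fix v :: real
      have "at (- exp v) within {..0} = at (- exp v)" by (rule at_within_interior) simp
      moreover have "- exp v \<le> 0" by simp
      ultimately have d1: "(e 0 has_vector_derivative e (Suc 0) (- exp v)) (at (- exp v))"
        using schwartz_seqD[OF e, of "- exp v" 0] by metis
      have d2: "((\<lambda>v. - exp v) has_vector_derivative - exp v) (at v)"
        by (intro has_vector_derivative_minus has_real_derivative_iff_has_vector_derivative[THEN iffD1, OF DERIV_exp])
      have d3: "((\<lambda>v. e 0 (- exp v)) has_vector_derivative - exp v *\<^sub>R e (Suc 0) (- exp v)) (at v)"
        using vector_diff_chain_at[OF d2 d1] by (simp only: comp_def)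
      have d4: "((\<lambda>v::real. exp (z * of_real v)) has_vector_derivative z * exp (z * of_real v)) (at v)"
        by (rule has_vector_derivative_real_field) (auto intro!: derivative_eq_intros)
      from has_vector_derivative_mult[OF d4 d3]
      show "(?F has_vector_derivative ?f v) (at v)"
        by (simp add: e'_def scaleR_conv_of_real algebra_simps)
      have "continuous_on UNIV ?f"
        using P.cont P'.cont by (intro continuous_on_add continuous_on_mult) (auto intro!: continuous_intros)
      thus "isCont ?f v" by (simp add: continuous_on_eq_continuous_at)
    next
      show "set_integrable lborel (einterval (-\<infinity>) \<infinity>) ?f"
        using int by (simp add: set_integrable_def)
      show "((?F \<circ> real_of_ereal) \<longlongrightarrow> 0) (at_right (-\<infinity>))"
      proof -
        obtain C where C: "\<And>v. norm (?F v) \<le> C * exp ((Re z - real 0) * v)" using bound[of 0] by blast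
        have "((\<lambda>v. C * exp ((Re z - real 0) * v)) \<longlongrightarrow> 0) at_bot" using z by simp real_asymp
        hence "(?F \<longlongrightarrow> 0) at_bot"
          by (rule Lim_null_comparison[rotated]) (use C in auto)
        thus ?thesis by (simp only: ereal_tendsto_simps)
      qed
      show "((?F \<circ> real_of_ereal) \<longlongrightarrow> 0) (at_left \<infinity>)"
      proof -
        obtain m :: nat where "real m > Re z" using reals_Archimedean2 by blast
        moreover obtain C where C: "\<And>v. norm (?F v) \<le> C * exp ((Re z - real m) * v)" using bound[of m] by blast
        ultimately have "((\<lambda>v. C * exp ((Re z - real m) * v)) \<longlongrightarrow> 0) at_top" by real_asymp
        hence "(?F \<longlongrightarrow> 0) at_top"
          by (rule Lim_null_comparison[rotated]) (use C in auto)
        thus ?thesis by (simp only: ereal_tendsto_simps)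
      qed
    qed auto
    hence "(LINT v|lborel. ?f v) = 0"
      by (simp add: interval_lebesgue_integral_def set_lebesgue_integral_def)
    moreover have "(LINT v|lborel. ?f v) = (LINT v|lborel. exp (z * of_real v) * e' 0 (- exp v)) +
        z * (LINT v|lborel. exp (z * of_real v) * e 0 (- exp v))"
      using int by simp
    ultimately show ?thesis by (simp add: add_eq_0_iff)
  qed
  show ?thesis
  proof (rule analytic_continuation_open[of "{z. Re z > 0}" UNIV P'.continuation "\<lambda>z. - z * P.continuation z"])
    show "{z. Re z > 0} \<noteq> {}" by (auto intro!: exI[of _ 1])
    show "P'.continuation holomorphic_on UNIV" by (rule P'.holomorphic_continuation) auto
    show "(\<lambda>z. - z * P.continuation z) holomorphic_on UNIV"
      by (intro holomorphic_intros P.holomorphic_continuation) auto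
    show "P'.continuation z = - z * P.continuation z" if "z \<in> {z. Re z > 0}" for z
      using that P.continuation_eq_integral[of z] P'.continuation_eq_integral[of z] parts[of z] by simp
    show "connected (UNIV :: complex set)" by (rule convex_connected[OF convex_UNIV])
  qed (use open_Re_greater in auto)
qed

text \<open>The \<open>remainder\<close> of the locale for the lattice sum, written out with
  \<open>e\<close> as a parameter because remainders of different sequences get compared.\<close>

definition lattice_remainder :: "(nat \<Rightarrow> real \<Rightarrow> complex) \<Rightarrow> nat \<Rightarrow> real \<Rightarrow> complex" where
  "lattice_remainder e K v = lattice_sum (e 0) (exp v)
     - (LINT v|lborel. exp (of_real v) * e 0 (- exp v)) * of_real (exp (- v))
     - (\<Sum>k<K. em_coeff k * e k 0 * of_real (exp (real k * v)))"

lemma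
  assumes e: "schwartz_seq e" and K: "even K" "K > 0" and z: "- real K - 1 < Re z" "Re z < 1 - real K"
  shows integrable_lattice_remainder: "integrable lborel (\<lambda>v. exp (z * of_real v) * lattice_remainder e K v)"
    and zeta_continuation_eq_remainder:
      "riemann_zeta z * laplace_expansion.continuation (\<lambda>v. e 0 (- exp v)) 0 (\<lambda>k. (-1) ^ k / fact k * e k 0) z
        = rGamma z * (LINT v|lborel. exp (z * of_real v) * lattice_remainder e K v)"
proof -
  interpret S: laplace_expansion "\<lambda>v. lattice_sum (e 0) (exp v)"
    "LINT v|lborel. exp (of_real v) * e 0 (- exp v)" "\<lambda>k. em_coeff k * e k 0"
    by (rule laplace_expansion_lattice_sum[OF e])
  have eq: "lattice_remainder e K = S.remainder K"
    by (simp add: fun_eq_iff lattice_remainder_def S.remainder_def)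
  have a: "em_coeff K * e K 0 = 0" using em_coeff_even_eq_0[OF K] by simp
  have K1: "K \<ge> 1" using K(2) by simp
  have "Re z \<noteq> Re 1" using z K1 by simp
  hence z1: "z \<noteq> 1" by metis
  show "integrable lborel (\<lambda>v. exp (z * of_real v) * lattice_remainder e K v)"
    unfolding eq by (rule S.integrable_remainder[OF a K1 z])
  show "riemann_zeta z * laplace_expansion.continuation (\<lambda>v. e 0 (- exp v)) 0 (\<lambda>k. (-1) ^ k / fact k * e k 0) z
        = rGamma z * (LINT v|lborel. exp (z * of_real v) * lattice_remainder e K v)"
    unfolding eq S.continuation_eq_remainder[OF a K1 z, symmetric]
    by (rule lattice_continuation_eq[OF e z1, symmetric])
qed

lemma rGamma_nonzero_off_reals:
  fixes z :: complex
  assumes "Im z \<noteq> 0"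
  shows "rGamma z \<noteq> 0"
proof -
  have "z \<notin> \<int>\<^sub>\<le>\<^sub>0" using assms by (auto elim!: nonpos_Ints_cases)
  thus ?thesis by (simp add: rGamma_eq_zero_iff)
qed

text \<open>Applying the operator \<open>x d/dx\<close> multiplies the transform by \<open>- z\<close>, so the square of \<open>z\<close> times the
  transform is again the transform of a lattice remainder and hence bounded on the line.\<close>

lemma lattice_remainder_transform_bound:
  assumes e: "schwartz_seq e" and K: "even K" "K > 0"
  shows "\<exists>B. \<forall>y. norm (LINT v|lborel. exp (Complex (- real K) y * of_real v) * lattice_remainder e K v) \<le> B * inverse (1 + y\<^sup>2)"
proof -
  define D :: "(nat \<Rightarrow> real \<Rightarrow> complex) \<Rightarrow> nat \<Rightarrow> real \<Rightarrow> complex"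
    where "D = (\<lambda>e n t. of_real t * e (Suc n) t + of_nat n * e n t)"
  define G where "G e z = (LINT v|lborel. exp (z * of_real v) * lattice_remainder e K v)" for e z
  define c where "c y = Complex (- real K) y" for y
  have D: "schwartz_seq (D e)" if "schwartz_seq e" for e
    unfolding D_def by (rule schwartz_seq_euler[OF that])
  have c: "- real K - 1 < Re (c y)" "Re (c y) < 1 - real K" for y by (simp_all add: c_def)
  \<comment> \<open>The common factor \<open>rGamma\<close> can be cancelled only off the real axis:
    it vanishes at \<open>c 0\<close>, which is - K.\<close>
  have GD: "G (D e) (c y) = - c y * G e (c y)" if e: "schwartz_seq e" and y: "y \<noteq> 0" for e y
  proof -
    have "rGamma (c y) * G (D e) (c y) = rGamma (c y) * (- c y * G e (c y))"
      using zeta_continuation_eq_remainder[OF e K c, of y] zeta_continuation_eq_remainder[OF D[OF e] K c, of y]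
        continuation_euler_derivative[OF e, of "c y"]
      unfolding G_def D_def by (simp add: mult_ac)
    moreover have "rGamma (c y) \<noteq> 0" using y by (intro rGamma_nonzero_off_reals) (simp add: c_def)
    ultimately show ?thesis using mult_left_cancel by blast
  qed
  \<comment> \<open>The modulus of exp(z v) depends only on Re z, so one L1 norm bounds the
    transform on the whole line.\<close>
  define B where "B e = (LINT v|lborel. norm (exp (c 0 * of_real v) * lattice_remainder e K v))" for e
  have GB: "norm (G e (c y)) \<le> B e" for e y
  proof -
    have "norm (G e (c y)) \<le> (LINT v|lborel. norm (exp (c y * of_real v) * lattice_remainder e K v))"
      unfolding G_def by (rule integral_norm_bound)
    also have "\<dots> = B e" unfolding B_def by (simp add: norm_mult c_def)
    finally show ?thesis .
  qed
  have "norm (G e (c y)) \<le> (B e + B (D (D e))) * inverse (1 + y\<^sup>2)" for y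
  proof -
    have "y\<^sup>2 * norm (G e (c y)) \<le> B (D (D e))"
    proof (cases "y = 0")
      case True
      thus ?thesis by (simp add: B_def)
    next
      case False
      have "\<bar>y\<bar> \<le> norm (c y)" using abs_Im_le_cmod[of "c y"] by (simp add: c_def)
      hence "y\<^sup>2 * norm (G e (c y)) \<le> norm (c y) ^ 2 * norm (G e (c y))"
        by (intro mult_right_mono) (simp_all add: abs_le_square_iff[symmetric])
      also have "\<dots> = norm (G (D (D e)) (c y))"
        unfolding GD[OF D[OF e] False] GD[OF e False] by (simp add: norm_mult power2_eq_square)
      also have "\<dots> \<le> B (D (D e))" by (rule GB)
      finally show ?thesis .
    qed
    hence "norm (G e (c y)) * (1 + y\<^sup>2) \<le> B e + B (D (D e))"
      using GB[of e y] by (simp add: distrib_left mult.commute)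
    moreover have "1 + y\<^sup>2 > 0" by (intro add_pos_nonneg) auto
    ultimately show ?thesis by (simp add: pos_le_divide_eq flip: divide_inverse)
  qed
  thus ?thesis unfolding G_def c_def by blast
qed

section \<open>Mellin inversion and the summation formula\<close>

lemma integrable_inverse_one_plus_square: "integrable lborel (\<lambda>y::real. inverse (1 + y\<^sup>2))"
  using integrable_inverse_1_plus_square by (simp add: set_integrable_def)

lemma mellin_inversion_lattice_remainder:
  fixes e :: "nat \<Rightarrow> real \<Rightarrow> complex" and K :: nat
  defines "G \<equiv> \<lambda>z. LINT v|lborel. exp (z * of_real v) * lattice_remainder e K v"
  assumes e: "schwartz_seq e" and K: "even K" "K > 0"
  shows "integrable lborel (\<lambda>y. exp (Complex (real K) y * of_real v) * G (- Complex (real K) y))"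
    and "(LINT y|lborel. exp (Complex (real K) y * of_real v) * G (- Complex (real K) y))
           = 2 * of_real pi * lattice_remainder e K v"
proof -
  interpret S: laplace_expansion "\<lambda>v. lattice_sum (e 0) (exp v)"
    "LINT v|lborel. exp (of_real v) * e 0 (- exp v)" "\<lambda>k. em_coeff k * e k 0"
    by (rule laplace_expansion_lattice_sum[OF e])
  have eq: "lattice_remainder e K = S.remainder K"
    by (simp add: fun_eq_iff lattice_remainder_def S.remainder_def)
  \<comment> \<open>With the weight exp(- K v), the transform at - K - i y is the Fourier transform
    of \<open>r\<close> at y.\<close>
  define r where "r v = exp (of_real (- real K * v)) * lattice_remainder e K v" for v
  define ft where "ft y = (LINT w|lborel. iexp (- (y * w)) * r w)" for y
  have ir: "integrable lborel r"
    using integrable_lattice_remainder[OF e K, of "of_real (- real K)"] unfolding r_def by simp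
  have [measurable]: "r \<in> borel_measurable borel" using ir by auto
  have "continuous_on UNIV (lattice_remainder e K)"
    unfolding lattice_remainder_def
    by (intro continuous_on_diff S.cont continuous_intros)
  hence cr: "continuous_on UNIV r"
    unfolding r_def by (intro continuous_on_mult) (auto intro!: continuous_intros)
  have a: "em_coeff K * e K 0 = 0" using em_coeff_even_eq_0[OF K] by simp
  obtain B where B: "\<And>v. norm (r v) \<le> B"
    using S.bounded_remainder[OF a] unfolding r_def eq by blast
  have ft_G: "ft y = G (- Complex (real K) y)" for y
    unfolding ft_def G_def r_def mult.assoc[symmetric] exp_add[symmetric]
    by (intro Bochner_Integration.integral_cong refl arg_cong2[of _ _ _ _ "(*)"] arg_cong[of _ _ exp])
       (simp add: complex_eq_iff)
  obtain C where C: "\<And>y. norm (LINT v|lborel. exp (Complex (- real K) y * of_real v) * lattice_remainder e K v) \<le> C * inverse (1 + y\<^sup>2)"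
    using lattice_remainder_transform_bound[OF e K] by blast
  have ift: "integrable lborel ft"
  proof (rule Bochner_Integration.integrable_bound)
    show "integrable lborel (\<lambda>y. C * inverse (1 + y\<^sup>2))"
      by (intro integrable_mult_right integrable_inverse_one_plus_square)
    show "ft \<in> borel_measurable lborel" unfolding ft_def by measurable
    have "norm (ft y) \<le> norm (C * inverse (1 + y\<^sup>2))" for y
    proof -
      have "- Complex (real K) y = Complex (- real K) (- y)" by (simp add: complex_eq_iff)
      hence "norm (ft y) \<le> C * inverse (1 + y\<^sup>2)"
        using C[of "- y"] by (simp add: ft_G G_def)
      thus ?thesis unfolding real_norm_def by (rule order_trans[OF _ abs_ge_self])
    qed
    thus "AE y in lborel. norm (ft y) \<le> norm (C * inverse (1 + y\<^sup>2))" by simp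
  qed
  have line: "exp (Complex (real K) y * of_real v) * G (- Complex (real K) y) =
      exp (of_real (real K * v)) * (iexp (y * v) * ft y)" for y
    unfolding ft_G[symmetric] mult.assoc[symmetric] exp_add[symmetric]
    by (intro arg_cong2[of _ _ _ _ "(*)"] arg_cong[of _ _ exp] refl) (simp add: complex_eq_iff)
  have "integrable lborel (\<lambda>y. iexp (y * v) * ft y)"
    by (rule Bochner_Integration.integrable_bound[OF ift]) (use ift in \<open>auto simp: norm_mult\<close>)
  thus "integrable lborel (\<lambda>y. exp (Complex (real K) y * of_real v) * G (- Complex (real K) y))"
    unfolding line by simp
  have "(LINT y|lborel. iexp (y * v) * ft y) = 2 * of_real pi * r v"
    using fourier_inversion[OF ir cr B] ift unfolding ft_def by blast
  moreover have "exp (of_real (real K * v)) * r v = lattice_remainder e K v"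
    by (simp add: r_def exp_minus)
  ultimately show "(LINT y|lborel. exp (Complex (real K) y * of_real v) * G (- Complex (real K) y))
           = 2 * of_real pi * lattice_remainder e K v"
    unfolding line integral_mult_right_zero by (simp only: mult.left_commute)
qed

theorem mainTheorem3:
  fixes F :: "real \<Rightarrow> complex" and N :: nat and t :: real
  assumes "schwartz_left F" and "N \<ge> 1" and "t < 0"
  shows "let g = remove_sings (\<lambda>s. Gamma (- s) * riemann_zeta (- s) *
                   complex_order_deriv0 F s * of_real (- t) powr s)
         in vline_integrable (2 * real N) g \<and>
            (\<lambda>n. F (real (Suc n) * t)) sums
              (- complex_order_deriv0 F (- 1) * inverse (of_real t)
               + (\<Sum>k = 0..2 * N - 1. riemann_zeta (- of_nat k) / fact k
                     * left_deriv k F 0 * of_real t ^ k)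
               + 1 / (2 * \<i> * of_real pi) * vline_integral (2 * real N) g)"
proof -
  define e where "e n = left_deriv n F" for n
  define K where "K = 2 * N"
  define x where "x = - t"
  have e: "schwartz_seq e" unfolding e_def by (rule schwartz_seq_left_deriv) fact
  have K: "even K" "K > 0" using assms(2) by (simp_all add: K_def)
  have x: "x > 0" "t = - x" using assms(3) by (simp_all add: x_def)
  have e0: "e 0 = F" by (simp add: e_def)
  interpret P: laplace_expansion "\<lambda>v. e 0 (- exp v)" 0 "\<lambda>k. (-1) ^ k / fact k * e k 0"
    by (rule laplace_expansion_schwartz[OF e])
  have H: "complex_order_deriv0 F s = P.continuation (- s)" for s
    using complex_order_deriv0_eq[OF assms(1)] by (simp add: e_def)
  define G where "G z = (LINT v|lborel. exp (z * of_real v) * lattice_remainder e K v)" for z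
  define f where "f s = Gamma (- s) * riemann_zeta (- s) * complex_order_deriv0 F s * of_real (- t) powr s" for s
  \<comment> \<open>The integrand on the line after cancelling Gamma(- s) against the
    \<open>rGamma\<close> of the transform; unlike \<open>f\<close> it needs no special treatment at
    y = 0.\<close>
  define h where "h y = exp (Complex (real K) y * of_real (ln x)) * G (- Complex (real K) y)" for y
  have h: "integrable lborel h" "integral\<^sup>L lborel h = 2 * of_real pi * lattice_remainder e K (ln x)"
    unfolding h_def G_def using mellin_inversion_lattice_remainder[OF e K] by simp_all

  \<comment> \<open>Off the real axis Gamma(- s) and zeta(- s) have no poles, so
    \<open>remove_sings\<close> changes nothing there. The one remaining point s = 2N of the line is
    a null set.\<close>
  have "f analytic_on {s}" if s: "Im s \<noteq> 0" for s
  proof -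
    let ?U = "{s. Im s \<noteq> 0}"
    have "open ?U" by (intro open_Collect_neq continuous_intros)
    moreover have "f holomorphic_on ?U"
    proof -
      have "(\<lambda>s. riemann_zeta (- s)) holomorphic_on ?U"
        by (rule holomorphic_on_compose_gen[of uminus ?U riemann_zeta "- {1}", unfolded comp_def])
           (auto intro!: holomorphic_intros holomorphic_riemann_zeta simp: complex_eq_iff)
      moreover have "(\<lambda>s. P.continuation (- s)) holomorphic_on ?U"
      proof -
        have "P.continuation holomorphic_on UNIV" by (rule P.holomorphic_continuation) simp
        from holomorphic_on_compose_gen[OF _ this, of uminus ?U] show ?thesis
          unfolding comp_def by (simp only: holomorphic_on_minus holomorphic_on_ident subset_UNIV)
      qed
      moreover have "(\<lambda>s. Gamma (- s)) holomorphic_on ?U"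
        by (intro holomorphic_intros) (auto elim!: nonpos_Ints_cases simp: complex_eq_iff)
      ultimately show ?thesis
        unfolding f_def H using x by (auto intro!: holomorphic_intros)
    qed
    ultimately show ?thesis using s analytic_at by blast
  qed
  hence g_eq: "remove_sings f s = f s" if "Im s \<noteq> 0" for s
    using that remove_sings_at_analytic by blast
  have f_eq: "f (Complex (real K) y) = h y" if y: "y \<noteq> 0" for y
  proof -
    let ?s = "Complex (real K) y"
    have "Gamma (- ?s) * (riemann_zeta (- ?s) * P.continuation (- ?s)) = Gamma (- ?s) * (rGamma (- ?s) * G (- ?s))"
      unfolding G_def using zeta_continuation_eq_remainder[OF e K, of "- ?s"] by simp
    also have "\<dots> = G (- ?s)"
      using rGamma_nonzero_off_reals[of "- ?s"] y by (simp add: rGamma_inverse_Gamma)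
    finally have "f ?s = G (- ?s) * of_real x powr ?s" by (simp add: f_def H x_def mult_ac)
    also have "of_real x powr ?s = exp (?s * of_real (ln x))"
      using x by (simp add: powr_def Ln_of_real)
    finally show ?thesis by (simp add: h_def mult_ac)
  qed
  have g_h: "h y = remove_sings f (Complex (real K) y)" if "y \<notin> {0}" for y
    using that g_eq f_eq by simp
  have "vline_integrable (real K) (remove_sings f)"
    unfolding vline_integrable_def
    by (rule integrable_discrete_difference[of "{0}" lborel h, THEN iffD1]) (use g_h h in auto)
  moreover have "(LINT y|lborel. remove_sings f (Complex (real K) y)) = integral\<^sup>L lborel h"
    by (rule integral_discrete_difference[of "{0}", symmetric]) (use g_h in auto)
  hence "1 / (2 * \<i> * of_real pi) * vline_integral (real K) (remove_sings f) = lattice_remainder e K (ln x)"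
    by (simp add: vline_integral_def h(2) mult.left_commute[of \<i>])
  moreover have "(\<lambda>n. F (real (Suc n) * t)) sums
      (- complex_order_deriv0 F (- 1) * inverse (of_real t)
        + (\<Sum>k = 0..2 * N - 1. riemann_zeta (- of_nat k) / fact k * left_deriv k F 0 * of_real t ^ k)
        + lattice_remainder e K (ln x))"
  proof -
    have "(\<lambda>n. F (real (Suc n) * t)) sums lattice_sum F x"
      using summable_sums[OF summable_lattice[OF e x(1), of 0]] unfolding lattice_sum_def e0 x(2)
      by (simp only: mult_minus_right)
    \<comment> \<open>Order -1 is the continuation at z = 1, where the Gamma factor is 1; t = - x
      turns - 1 / t into 1 / x.\<close>
    moreover have "- complex_order_deriv0 F (- 1) * inverse (of_real t) =
        (LINT v|lborel. exp (of_real v) * e 0 (- exp v)) * of_real (exp (- ln x))"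
      using P.continuation_eq_integral[of 1] x by (simp add: H exp_minus)
    moreover have "(\<Sum>k = 0..2 * N - 1. riemann_zeta (- of_nat k) / fact k * left_deriv k F 0 * of_real t ^ k) =
        (\<Sum>k<K. em_coeff k * e k 0 * of_real (exp (real k * ln x)))"
    proof (rule sum.cong)
      show "{0..2 * N - 1} = {..<K}" using assms(2) by (auto simp: K_def)
      fix k
      have "of_real t ^ k = (-1) ^ k * (of_real x ^ k :: complex)"
        unfolding x(2) of_real_minus by (rule power_minus)
      moreover have "of_real (exp (real k * ln x)) = (of_real x ^ k :: complex)"
        using x by (simp add: exp_of_nat_mult)
      moreover have "(-1) ^ k * (-1) ^ k = (1 :: complex)"
        by (simp flip: power_mult_distrib)
      \<comment> \<open>The sign (-1)^k of zeta(- k) cancels the one from t^k = (-1)^k x^k.\<close>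
      ultimately show "riemann_zeta (- of_nat k) / fact k * left_deriv k F 0 * of_real t ^ k =
          em_coeff k * e k 0 * of_real (exp (real k * ln x))"
        by (simp add: riemann_zeta_minus_of_nat e_def mult_ac)
    qed
    ultimately show ?thesis
      using x by (simp add: lattice_remainder_def e0 del: of_real_exp)
  qed
  ultimately show ?thesis
    unfolding Let_def f_def [symmetric, abs_def] by (simp add: K_def)
qed

end
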